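(* Let $m,n$ be positive integers and $k\ge 2$ an integer. Let $P\in\mathbb{R}[x_1,\ldots,x_n]$ be a polynomial that has a zero of multiplicity at least $k$ at every point of $mB^n\setminus\{\mathbf 0\}$ and a zero of multiplicity exactly $l$ at $\mathbf 0$, where $l\ge 0$ is an integer. (i) If $l=k-1$, then $\deg P\ge mn+(m+1)(k-1)$. (ii) If $l\le k-2$, $k\in\{2,3,4\}$ and $n\ge k-1$, then $\deg P\ge mn+(m+1)(k-1)-1$. Moreover both bounds are attained. In case (i) there is such a polynomial with $l=k-1$ and $\deg P=mn+(m+1)(k-1)$. In case (ii), for every $l\in\{0,\ldots,k-2\}$ there is such a polynomial with zero multiplicity exactly $l$ at $\mathbf 0$ and $\deg P=mn+(m+1)(k-1)-1$.
   Context: $mB^n=\{0,1,\ldots,m\}^n\subseteq\mathbb{R}^n$. For a nonzero polynomial $f\in\mathbb{R}[x_1,\ldots,x_n]$ and a point $\mathbf a=(a_1,\ldots,a_n)$, the multiplicity of the zero of $f$ at $\mathbf a$ is the minimum total degree of a monomial occurring in the expansion of $f(x_1+a_1,\ldots,x_n+a_n)$; multiplicity $0$ means $f(\mathbf a)\neq 0$. The zero polynomial has a zero of every multiplicity. Equivalently, $f$ has a zero of multiplicity at least $k$ at $\mathbf a$ if and only if all partial derivatives of $f$ of order less than $k$ vanish at $\mathbf a$. *)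

theory Defs
  imports Complex_Main "HOL-Library.Poly_Mapping"
begin

text \<open>Real multivariate polynomials in variables x_0, x_1, ... are represented as
finitely supported maps from monomials (finitely supported exponent vectors) to coefficients.
Multiplication is the convolution (polynomial multiplication) from Poly_Mapping.\<close>

type_synonym mpoly_r = "(nat \<Rightarrow>\<^sub>0 nat) \<Rightarrow>\<^sub>0 real"

definition mvar :: "nat \<Rightarrow> mpoly_r" where
  "mvar i = Poly_Mapping.single (Poly_Mapping.single i 1) 1"

definition mconst :: "real \<Rightarrow> mpoly_r" where
  "mconst c = Poly_Mapping.single 0 c"

definition mon_deg :: "(nat \<Rightarrow>\<^sub>0 nat) \<Rightarrow> nat" where
  "mon_deg \<alpha> = (\<Sum>i\<in>Poly_Mapping.keys \<alpha>. Poly_Mapping.lookup \<alpha> i)"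

definition total_deg :: "mpoly_r \<Rightarrow> nat" where
  "total_deg P = (if P = 0 then 0 else Max (mon_deg ` Poly_Mapping.keys P))"

definition in_vars :: "nat \<Rightarrow> mpoly_r \<Rightarrow> bool" where
  "in_vars n P \<longleftrightarrow> (\<forall>\<alpha>\<in>Poly_Mapping.keys P. Poly_Mapping.keys \<alpha> \<subseteq> {..<n})"

definition shift :: "mpoly_r \<Rightarrow> (nat \<Rightarrow> real) \<Rightarrow> mpoly_r" where
  "shift P a = (\<Sum>\<alpha>\<in>Poly_Mapping.keys P. mconst (Poly_Mapping.lookup P \<alpha>) *
                  (\<Prod>i\<in>Poly_Mapping.keys \<alpha>. (mvar i + mconst (a i)) ^ Poly_Mapping.lookup \<alpha> i))"

text \<open>P has a zero of multiplicity at least k at a: every monomial occurring in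
P(x + a) has total degree at least k (vacuous for the zero polynomial).\<close>
definition mult_ge :: "mpoly_r \<Rightarrow> (nat \<Rightarrow> real) \<Rightarrow> nat \<Rightarrow> bool" where
  "mult_ge P a k \<longleftrightarrow> (\<forall>\<alpha>\<in>Poly_Mapping.keys (shift P a). k \<le> mon_deg \<alpha>)"

definition mult_eq :: "mpoly_r \<Rightarrow> (nat \<Rightarrow> real) \<Rightarrow> nat \<Rightarrow> bool" where
  "mult_eq P a l \<longleftrightarrow> mult_ge P a l \<and> \<not> mult_ge P a (Suc l)"

definition grid :: "nat \<Rightarrow> nat \<Rightarrow> (nat \<Rightarrow> real) set" where
  "grid m n = {a. (\<forall>i<n. a i \<in> real ` {0..m}) \<and> (\<forall>i\<ge>n. a i = 0)}"

definition admissible :: "nat \<Rightarrow> nat \<Rightarrow> nat \<Rightarrow> nat \<Rightarrow> mpoly_r \<Rightarrow> bool" where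
  "admissible m n k l P \<longleftrightarrow> in_vars n P \<and>
     (\<forall>a\<in>grid m n - {(\<lambda>_. 0)}. mult_ge P a k) \<and> mult_eq P (\<lambda>_. 0) l"

end

theory Submission
  imports Defs "HOL-Library.FuncSet" "HOL-Computational_Algebra.Polynomial_FPS"
    "HOL-Computational_Algebra.Polynomial_Factorial" "HOL-Computational_Algebra.Field_as_Ring"
begin

text \<open>
  Let \<open>g(x) = x (x - 1) \<dots> (x - m)\<close> and \<open>|\<beta>| = k - 1\<close>. The sum of all residues of \<open>P / \<Prod> g(x\<^sub>i) ^ (\<beta>\<^sub>i + 1)\<close> at grid
  points is a functional of the top-degree part of \<open>P\<close>, vanishing when \<open>deg P < mn + (m + 1)(k - 1)\<close>, and if \<open>P\<close> has
  multiplicity at least \<open>k\<close> at all nonzero grid points then only the residue at the origin contributes: it is the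
  coefficient of \<open>x ^ \<beta>\<close> in \<open>P * \<Prod> E(x\<^sub>i) ^ (\<beta>\<^sub>i + 1)\<close>, up to a constant, where \<open>E = 1 / \<Prod>j=1..m. (1 - x / j)\<close>.
  This gives bound (i) at once. For bound (ii), apply the same to \<open>x\<^sub>i P\<close> for all \<open>i\<close>: comparing different \<open>\<beta>\<close> and \<open>i\<close>
  gives linear equations for the jet of \<open>P\<close> at the origin, which force its part of order at most \<open>k - 2\<close> to
  vanish because the coefficients of \<open>E\<close> are nonnegative and the linear one is positive.

  For sharpness in (ii), start from \<open>x\<^sub>0 ^ l * u ^ k\<close> with \<open>u = \<Prod>i<n. \<Prod>j=1..m. (x\<^sub>i - j)\<close> and reduce its degree modulo products
  of \<open>k\<close> of the \<open>g(x\<^sub>i)\<close> and modulo \<open>u\<close> times products of \<open>k - 1\<close> of them; these do not affect the jet of order at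
  most \<open>k - 2\<close> at the origin, and their leading monomials divide every monomial of degree at least \<open>mn + (m + 1)(k - 1)\<close>.
\<close>

section \<open>Coefficients of shifted polynomials\<close>

lemma poly_mapping_sum_single:
  "P = (\<Sum>\<alpha>\<in>Poly_Mapping.keys P. Poly_Mapping.single \<alpha> (Poly_Mapping.lookup P \<alpha>))"
  by (rule poly_mapping_eqI)
     (simp add: lookup_sum lookup_single when_def in_keys_iff)

text \<open>Turns a function on an index set into an exponent vector, so that sums over exponents
  can run over \<open>PiE\<close> boxes.\<close>

definition mon_of :: "nat set \<Rightarrow> (nat \<Rightarrow> nat) \<Rightarrow> (nat \<Rightarrow>\<^sub>0 nat)" where
  "mon_of A f = (\<Sum>i\<in>A. Poly_Mapping.single i (f i))"

lemma lookup_mon_of: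
  "finite A \<Longrightarrow> Poly_Mapping.lookup (mon_of A f) j = (if j \<in> A then f j else 0)"
  by (simp add: mon_of_def lookup_sum lookup_single when_def)

lemma mon_of_eq_iff:
  assumes "finite A" "f \<in> PiE A B" "Poly_Mapping.keys s \<subseteq> A"
  shows "mon_of A f = s \<longleftrightarrow> f = restrict (Poly_Mapping.lookup s) A"
proof
  assume "mon_of A f = s"
  then have "Poly_Mapping.lookup s = (\<lambda>j. if j \<in> A then f j else 0)"
    using lookup_mon_of[OF assms(1)] by fastforce
  then show "f = restrict (Poly_Mapping.lookup s) A"
    using assms(2) by (auto simp: fun_eq_iff PiE_def extensional_def)
next
  assume "f = restrict (Poly_Mapping.lookup s) A"
  then show "mon_of A f = s"
    using assms by (intro poly_mapping_eqI) (auto simp: lookup_mon_of in_keys_iff)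
qed

lemma mon_deg_eq_sum:
  assumes "finite A" "Poly_Mapping.keys \<alpha> \<subseteq> A"
  shows "mon_deg \<alpha> = (\<Sum>i\<in>A. Poly_Mapping.lookup \<alpha> i)"
  unfolding mon_deg_def using assms by (intro sum.mono_neutral_left) (auto simp: in_keys_iff)

lemma keys_mon_of: "finite A \<Longrightarrow> Poly_Mapping.keys (mon_of A f) \<subseteq> A"
  by (auto simp: in_keys_iff lookup_mon_of split: if_splits)

lemma mon_deg_mon_of: "finite A \<Longrightarrow> mon_deg (mon_of A f) = sum f A"
  by (simp add: mon_deg_eq_sum[OF _ keys_mon_of] lookup_mon_of)

lemma mon_deg_add: "mon_deg (\<alpha> + \<beta>) = mon_deg \<alpha> + mon_deg \<beta>"
proof -
  let ?A = "Poly_Mapping.keys \<alpha> \<union> Poly_Mapping.keys \<beta>"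
  have "Poly_Mapping.keys (\<alpha> + \<beta>) \<subseteq> ?A" by (rule Poly_Mapping.keys_add)
  then show ?thesis
    by (simp add: mon_deg_eq_sum[of ?A] lookup_add sum.distrib)
qed

lemma mon_deg_single: "mon_deg (Poly_Mapping.single i e) = e"
  by (simp add: mon_deg_def)

lemma mon_deg_0 [simp]: "mon_deg 0 = 0"
  by (simp add: mon_deg_def)

lemma mult_mvar_power: "mvar i ^ t = Poly_Mapping.single (Poly_Mapping.single i t) 1"
  by (induction t) (simp_all add: mvar_def mult_single single_add[symmetric])

lemma mconst_power: "mconst c ^ t = mconst (c ^ t)"
  by (induction t) (simp_all add: mconst_def mult_single)

lemma prod_single:
  "finite A \<Longrightarrow> (\<Prod>i\<in>A. Poly_Mapping.single (\<mu> i) (c i :: real)) = Poly_Mapping.single (sum \<mu> A) (prod c A)"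
  for \<mu> :: "'b \<Rightarrow> 'a :: comm_monoid_add"
  by (induction A rule: finite_induct) (simp_all add: mult_single)

lemma of_nat_eq_mconst: "of_nat q = mconst (real q)"
proof (induction q)
  case (Suc q)
  then show ?case by (simp add: mconst_def single_add algebra_simps flip: single_one)
qed (simp add: mconst_def)

lemma linear_power_expand:
  "(mvar i + mconst c) ^ e =
     (\<Sum>t\<le>e. Poly_Mapping.single (Poly_Mapping.single i t) (real (e choose t) * c ^ (e - t)))"
  unfolding binomial_ring mult_mvar_power mconst_power of_nat_eq_mconst
  by (simp add: mconst_def mult_single del: single_of_nat)

lemma lookup_single_mult_self:
  "Poly_Mapping.lookup (Poly_Mapping.single \<mu> c * Q) (\<mu> + s) = c * Poly_Mapping.lookup Q s"
  for Q :: mpoly_r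
proof -
  have "Poly_Mapping.lookup (Poly_Mapping.single \<mu> c * Q) (\<mu> + s) =
      Poly_Mapping.lookup (Poly_Mapping.single \<mu> c *
        (\<Sum>\<beta>\<in>Poly_Mapping.keys Q. Poly_Mapping.single \<beta> (Poly_Mapping.lookup Q \<beta>))) (\<mu> + s)"
    by (simp only: poly_mapping_sum_single[symmetric])
  also have "\<dots> = c * Poly_Mapping.lookup Q s"
    by (simp add: sum_distrib_left mult_single lookup_sum lookup_single when_def in_keys_iff)
  finally show ?thesis .
qed

text \<open>Expand each power by the binomial theorem and multiply out. Different choice functions
  give different monomials, so at most one summand contributes.\<close>

lemma lookup_prod_linear:
  assumes "finite A" "Poly_Mapping.keys s \<subseteq> A"
  shows "Poly_Mapping.lookup (\<Prod>i\<in>A. (mvar i + mconst (a i)) ^ e i) s =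
    (\<Prod>i\<in>A. real (e i choose Poly_Mapping.lookup s i) * a i ^ (e i - Poly_Mapping.lookup s i))"
proof -
  let ?w = "\<lambda>i t. real (e i choose t) * a i ^ (e i - t)"
  let ?s = "Poly_Mapping.lookup s"
  let ?B = "PiE A (\<lambda>i. {..e i})"
  have "Poly_Mapping.lookup (\<Prod>i\<in>A. (mvar i + mconst (a i)) ^ e i) s =
      Poly_Mapping.lookup (\<Sum>f\<in>?B. Poly_Mapping.single (mon_of A f) (\<Prod>i\<in>A. ?w i (f i))) s"
    unfolding linear_power_expand using assms
    by (subst prod_sum_PiE) (auto simp: prod_single mon_of_def)
  also have "\<dots> = (\<Sum>f\<in>?B. if f = restrict ?s A then (\<Prod>i\<in>A. ?w i (f i)) else 0)"
    unfolding lookup_sum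
    by (intro sum.cong refl) (simp add: lookup_single when_def mon_of_eq_iff[OF assms(1) _ assms(2)])
  also have "\<dots> = (if restrict ?s A \<in> ?B then (\<Prod>i\<in>A. ?w i (?s i)) else 0)"
    using assms(1) by (simp add: finite_PiE)
  \<comment> \<open>Outside the box some exponent of \<open>s\<close> exceeds \<open>e i\<close>,
    and the binomial coefficient there is already 0.\<close>
  also have "\<dots> = (\<Prod>i\<in>A. ?w i (?s i))"
  proof (cases "restrict ?s A \<in> ?B")
    case False
    then obtain i where "i \<in> A" "e i < ?s i"
      by (auto simp: PiE_iff not_le)
    then show ?thesis using False assms(1) by (auto simp: binomial_eq_0 intro!: prod_zero[symmetric] bexI[of _ i])
  qed simp
  finally show ?thesis .
qed

text \<open>The coefficients of a shift are the scaled (Hasse) derivatives at \<open>a\<close>.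
  Running all products over one common index set \<open>A\<close> gives the product form to which
  univariate functionals can be applied factor by factor.\<close>

lemma lookup_shift:
  assumes "finite A" "Poly_Mapping.keys s \<subseteq> A" "\<And>\<alpha>. \<alpha> \<in> Poly_Mapping.keys P \<Longrightarrow> Poly_Mapping.keys \<alpha> \<subseteq> A"
  shows "Poly_Mapping.lookup (shift P a) s = (\<Sum>\<alpha>\<in>Poly_Mapping.keys P. Poly_Mapping.lookup P \<alpha> *
    (\<Prod>i\<in>A. real (Poly_Mapping.lookup \<alpha> i choose Poly_Mapping.lookup s i) *
       a i ^ (Poly_Mapping.lookup \<alpha> i - Poly_Mapping.lookup s i)))"
proof -
  have ext: "(\<Prod>i\<in>Poly_Mapping.keys \<alpha>. (mvar i + mconst (a i)) ^ Poly_Mapping.lookup \<alpha> i) =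
      (\<Prod>i\<in>A. (mvar i + mconst (a i)) ^ Poly_Mapping.lookup \<alpha> i)"
    if "\<alpha> \<in> Poly_Mapping.keys P" for \<alpha>
    using assms(1) assms(3)[OF that] by (intro prod.mono_neutral_left) (auto simp: in_keys_iff)
  have mc: "Poly_Mapping.lookup (mconst c * Q) s = c * Poly_Mapping.lookup Q s" for c Q
    using lookup_single_mult_self[of 0 c Q s] by (simp add: mconst_def)
  show ?thesis
    unfolding shift_def lookup_sum mc
    by (intro sum.cong refl) (simp add: ext lookup_prod_linear[OF assms(1,2)])
qed

text \<open>Exponents cannot cancel, so only the two constant terms contribute.\<close>

lemma lookup_mult_0:
  "Poly_Mapping.lookup (P * Q) 0 = Poly_Mapping.lookup P 0 * Poly_Mapping.lookup Q 0"
  for P Q :: mpoly_r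
proof -
  have iff: "0 = \<alpha> + \<beta> \<longleftrightarrow> \<alpha> = 0 \<and> \<beta> = 0" "\<alpha> + \<beta> = 0 \<longleftrightarrow> \<alpha> = 0 \<and> \<beta> = 0" for \<alpha> \<beta> :: "nat \<Rightarrow>\<^sub>0 nat"
    by (auto simp: poly_mapping_eq_iff fun_eq_iff lookup_add)
  let ?P = "Poly_Mapping.lookup P" and ?Q = "Poly_Mapping.lookup Q"
  have "Poly_Mapping.lookup (P * Q) 0 =
     Poly_Mapping.lookup ((\<Sum>\<alpha>\<in>Poly_Mapping.keys P. Poly_Mapping.single \<alpha> (?P \<alpha>)) *
       (\<Sum>\<beta>\<in>Poly_Mapping.keys Q. Poly_Mapping.single \<beta> (?Q \<beta>))) 0"
    by (simp only: poly_mapping_sum_single[symmetric])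
  also have "\<dots> = (\<Sum>\<alpha>\<in>Poly_Mapping.keys P. \<Sum>\<beta>\<in>Poly_Mapping.keys Q.
      (if \<alpha> = 0 then ?P \<alpha> else 0) * (if \<beta> = 0 then ?Q \<beta> else 0))"
    by (simp add: sum_product mult_single lookup_sum lookup_single when_def iff)
       (intro sum.cong refl; simp)
  also have "\<dots> = ?P 0 * ?Q 0"
    by (simp add: sum_product[symmetric] in_keys_iff)
  finally show ?thesis .
qed

section \<open>Substitution of \<open>x + a\<close> as a ring homomorphism\<close>

definition mon_lin :: "(nat \<Rightarrow> real) \<Rightarrow> (nat \<Rightarrow>\<^sub>0 nat) \<Rightarrow> mpoly_r" where
  "mon_lin a \<alpha> = (\<Prod>i\<in>Poly_Mapping.keys \<alpha>. (mvar i + mconst (a i)) ^ Poly_Mapping.lookup \<alpha> i)"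

lemma mon_lin_eq:
  assumes "finite A" "Poly_Mapping.keys \<alpha> \<subseteq> A"
  shows "mon_lin a \<alpha> = (\<Prod>i\<in>A. (mvar i + mconst (a i)) ^ Poly_Mapping.lookup \<alpha> i)"
  unfolding mon_lin_def using assms by (intro prod.mono_neutral_left) (auto simp: in_keys_iff)

lemma mon_lin_add: "mon_lin a (\<alpha> + \<beta>) = mon_lin a \<alpha> * mon_lin a \<beta>"
proof -
  let ?A = "Poly_Mapping.keys \<alpha> \<union> Poly_Mapping.keys \<beta>"
  have "Poly_Mapping.keys (\<alpha> + \<beta>) \<subseteq> ?A" by (rule Poly_Mapping.keys_add)
  then show ?thesis
    by (simp add: mon_lin_eq[of ?A] lookup_add power_add prod.distrib)
qed

lemma mconst_0 [simp]: "mconst 0 = 0" by (simp add: mconst_def)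
lemma mconst_add: "mconst (c + d) = mconst c + mconst d" by (simp add: mconst_def single_add)
lemma mconst_mult: "mconst (c * d) = mconst c * mconst d" by (simp add: mconst_def mult_single)

lemma shift_eq:
  assumes "finite A" "Poly_Mapping.keys P \<subseteq> A"
  shows "shift P a = (\<Sum>\<alpha>\<in>A. mconst (Poly_Mapping.lookup P \<alpha>) * mon_lin a \<alpha>)"
  unfolding shift_def mon_lin_def[symmetric]
  using assms by (intro sum.mono_neutral_left) (auto simp: in_keys_iff)

lemma shift_add: "shift (P + Q) a = shift P a + shift Q a"
proof -
  let ?A = "Poly_Mapping.keys P \<union> Poly_Mapping.keys Q"
  have "Poly_Mapping.keys (P + Q) \<subseteq> ?A" by (rule Poly_Mapping.keys_add)
  then show ?thesis
    by (simp add: shift_eq[of ?A] lookup_add mconst_add algebra_simps sum.distrib)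
qed

lemma shift_single: "shift (Poly_Mapping.single \<alpha> c) a = mconst c * mon_lin a \<alpha>"
  by (subst shift_eq[of "{\<alpha>}"]) auto

lemma shift_0 [simp]: "shift 0 a = 0" by (simp add: shift_def)

lemma shift_sum: "finite A \<Longrightarrow> shift (sum f A) a = (\<Sum>x\<in>A. shift (f x) a)"
  by (induction A rule: finite_induct) (simp_all add: shift_add)

lemma shift_mult: "shift (P * Q) a = shift P a * shift Q a"
proof -
  let ?P = "Poly_Mapping.lookup P" and ?Q = "Poly_Mapping.lookup Q"
  have "shift (P * Q) a =
     shift ((\<Sum>\<alpha>\<in>Poly_Mapping.keys P. Poly_Mapping.single \<alpha> (?P \<alpha>)) * (\<Sum>\<beta>\<in>Poly_Mapping.keys Q. Poly_Mapping.single \<beta> (?Q \<beta>))) a"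
    by (simp only: poly_mapping_sum_single[symmetric])
  also have "\<dots> = (\<Sum>\<alpha>\<in>Poly_Mapping.keys P. \<Sum>\<beta>\<in>Poly_Mapping.keys Q. mconst (?P \<alpha>) * mon_lin a \<alpha> * (mconst (?Q \<beta>) * mon_lin a \<beta>))"
    by (simp add: sum_product mult_single shift_sum shift_single mon_lin_add mconst_mult mult_ac)
  also have "\<dots> = shift P a * shift Q a"
    by (simp add: sum_product[symmetric] shift_def mon_lin_def)
  finally show ?thesis .
qed

lemma mon_of_lookup: "finite A \<Longrightarrow> Poly_Mapping.keys \<alpha> \<subseteq> A \<Longrightarrow> mon_of A (Poly_Mapping.lookup \<alpha>) = \<alpha>"
  by (rule poly_mapping_eqI) (auto simp: lookup_mon_of in_keys_iff)

lemma shift_zero [simp]: "shift P (\<lambda>_. 0) = P"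
proof -
  have "mon_lin (\<lambda>_. 0) \<alpha> = Poly_Mapping.single \<alpha> 1" for \<alpha>
    using mon_of_lookup[of "Poly_Mapping.keys \<alpha>" \<alpha>]
    by (simp add: mon_lin_def mult_mvar_power prod_single mon_of_def)
  then have "shift P (\<lambda>_. 0) = (\<Sum>\<alpha>\<in>Poly_Mapping.keys P. Poly_Mapping.single \<alpha> (Poly_Mapping.lookup P \<alpha>))"
    by (simp add: shift_eq[OF finite_keys order_refl] mconst_def mult_single)
  then show ?thesis by (simp flip: poly_mapping_sum_single)
qed

lemma mon_deg_le_total_deg: "\<alpha> \<in> Poly_Mapping.keys P \<Longrightarrow> mon_deg \<alpha> \<le> total_deg P"
  by (auto simp: total_deg_def)

section \<open>Univariate residue functionals\<close>

text \<open>Partial fractions with denominators cleared. The powers at distinct nodes are coprime,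
  and a new node \<open>z\<close> is added by one Bezout identity between its power and the product
  of the others.\<close>

lemma bezout_linear_powers:
  fixes A :: "nat set"
  assumes "finite A" "A \<noteq> {}"
  shows "\<exists>w. (\<Sum>a\<in>A. w a * (\<Prod>c\<in>A - {a}. [:- real c, 1:] ^ N)) = 1"
  using assms
proof (induction A rule: finite_ne_induct)
  case (singleton x)
  show ?case by (rule exI[of _ "\<lambda>_. 1"]) simp
next
  case (insert z A)
  let ?p = "\<lambda>c. [:- real c, 1:] ^ N"
  from insert.IH obtain w where w: "(\<Sum>a\<in>A. w a * prod ?p (A - {a})) = 1" by blast
  have "coprime (?p z) (prod ?p A)"
  proof (rule prod_coprime_right)
    fix c assume "c \<in> A"
    with insert.hyps have "c \<noteq> z" by auto
    have "coprime [:- real z, 1:] [:- real c, 1:]"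
    proof (rule coprimeI)
      fix d assume "d dvd [:- real z, 1:]" "d dvd [:- real c, 1:]"
      then have "d dvd [:- real z, 1:] - [:- real c, 1:]" by (rule dvd_diff)
      then have "d dvd [:real c - real z:]" by simp
      with \<open>c \<noteq> z\<close> show "is_unit d"
        by (meson dvd_trans is_unit_const_poly_iff dvd_field_iff eq_iff_diff_eq_0 of_nat_eq_iff)
    qed
    then show "coprime (?p z) (?p c)" by simp
  qed
  then obtain u v where uv: "u * ?p z + v * prod ?p A = 1"
    by (metis bezout_coefficients_fst_snd coprime_iff_gcd_eq_1)
  define w' where "w' a = (if a = z then v else u * w a)" for a
  have "(\<Sum>a\<in>insert z A. w' a * prod ?p (insert z A - {a})) =
      v * prod ?p A + (\<Sum>a\<in>A. u * w a * (?p z * prod ?p (A - {a})))"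
  proof -
    have "w' a * prod ?p (insert z A - {a}) = u * w a * (?p z * prod ?p (A - {a}))" if "a \<in> A" for a
    proof -
      have "insert z A - {a} = insert z (A - {a})" "a \<noteq> z" using that insert.hyps by auto
      then show ?thesis using insert.hyps by (simp add: w'_def)
    qed
    moreover have "insert z A - {z} = A" using insert.hyps by auto
    ultimately show ?thesis using insert.hyps by (simp add: w'_def)
  qed
  also have "\<dots> = v * prod ?p A + u * ?p z * (\<Sum>a\<in>A. w a * prod ?p (A - {a}))"
    by (simp add: sum_distrib_left mult_ac)
  also have "\<dots> = 1" using uv w by (simp add: algebra_simps)
  finally show ?case by blast
qed

lemma pcompose_power: "pcompose (p ^ n) q = pcompose p q ^ n" for p q :: "'a :: comm_ring_1 poly"
  by (induction n) (simp_all add: pcompose_mult pcompose_1)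

text \<open>Translation is an automorphism of the polynomial ring carrying \<open>(x - a)^N\<close>
  to \<open>x^N\<close>, and divisibility by \<open>x^N\<close> can be read off the
  coefficients.\<close>

lemma linear_power_dvd_iff_coeff_pcompose:
  "[:- a, 1:] ^ N dvd f \<longleftrightarrow> (\<forall>s<N. coeff (pcompose f [:a, 1:]) s = 0)" for a :: real
proof -
  have inv: "pcompose (pcompose f [:a, 1:]) [:-a, 1:] = f" "pcompose (pcompose f [:-a, 1:]) [:a, 1:] = f" for f
    by (simp_all flip: pcompose_assoc add: pcompose_pCons)
  have m: "monom 1 N = [:0, 1 :: real:] ^ N"
    by (simp add: monom_altdef)
  have *: "pcompose ([:0, 1 :: real:] ^ N) [:-a, 1:] = [:-a, 1:] ^ N" "pcompose ([:-a, 1:] ^ N) [:a, 1:] = [:0, 1:] ^ N"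
    by (simp_all add: pcompose_power pcompose_pCons)
  have "[:- a, 1:] ^ N dvd f \<longleftrightarrow> monom 1 N dvd pcompose f [:a, 1:]"
    unfolding m
  proof
    assume "[:- a, 1:] ^ N dvd f"
    then obtain h where "f = [:- a, 1:] ^ N * h" by blast
    then have "pcompose f [:a, 1:] = [:0, 1:] ^ N * pcompose h [:a, 1:]"
      by (simp add: pcompose_mult *)
    then show "[:0, 1:] ^ N dvd pcompose f [:a, 1:]" by simp
  next
    assume "[:0, 1:] ^ N dvd pcompose f [:a, 1:]"
    then obtain h where "pcompose f [:a, 1:] = [:0, 1:] ^ N * h" by blast
    then have "f = [:-a, 1:] ^ N * pcompose h [:-a, 1:]"
      using inv(1)[of f] by (simp add: pcompose_mult *)
    then show "[:- a, 1:] ^ N dvd f" by simp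
  qed
  then show ?thesis by (simp add: monom_1_dvd_iff')
qed

lemma taylor_remainder:
  fixes a :: real
  obtains q where "f = (\<Sum>s\<le>b. smult (coeff (pcompose f [:a, 1:]) s) ([:- a, 1:] ^ s)) + [:- a, 1:] ^ Suc b * q"
proof -
  let ?F = "coeff (pcompose f [:a, 1:])"
  let ?T = "\<Sum>s\<le>b. smult (?F s) ([:- a, 1:] ^ s)"
  have "pcompose ?T [:a, 1:] = (\<Sum>s\<le>b. smult (?F s) (monom 1 s))"
    by (simp add: pcompose_sum pcompose_smult pcompose_power pcompose_pCons monom_altdef)
  then have "coeff (pcompose (f - ?T) [:a, 1:]) s = 0" if "s < Suc b" for s
    using that by (simp add: pcompose_diff coeff_sum if_distrib[of "(*) _"] cong: if_cong)
  then have "[:- a, 1:] ^ Suc b dvd f - ?T"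
    using linear_power_dvd_iff_coeff_pcompose by blast
  then obtain q where "f - ?T = [:- a, 1:] ^ Suc b * q" by blast
  then have "f = ?T + [:- a, 1:] ^ Suc b * q" by (simp add: algebra_simps)
  then show ?thesis by (rule that)
qed

text \<open>\<open>residue_dual m b d w\<close>: some functional built from the jets of order at most \<open>b\<close> at the nodes
  \<open>0, \<dots>, m\<close> kills all polynomials of degree less than \<open>d\<close>, and \<open>w\<close> is its part at the node 0. The sums
  below are its values on the monomials \<open>x ^ t\<close>.\<close>

definition residue_dual :: "nat \<Rightarrow> nat \<Rightarrow> nat \<Rightarrow> (nat \<Rightarrow> real) \<Rightarrow> bool" where
  "residue_dual m b d w \<longleftrightarrow> (\<exists>c.
     (\<forall>t<d. (\<Sum>a\<le>m. \<Sum>s\<le>b. c a s * (real (t choose s) * real a ^ (t - s))) = 0) \<and>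
     (\<forall>s\<le>b. c 0 s = w s))"

text \<open>The series \<open>E\<close> of the overview: the reciprocal of the linear factors at the
  nonzero nodes, each normalised to constant term 1.\<close>

definition inv_tail :: "nat \<Rightarrow> real fps" where
  "inv_tail m = inverse (\<Prod>j=1..m. 1 - fps_const (1 / real j) * fps_X)"

lemma inv_tail_mult: "inv_tail m * fps_of_poly (\<Prod>j=1..m. [:- real j, 1:]) = fps_const (\<Prod>j=1..m. - real j)"
proof -
  let ?L = "\<Prod>j=1..m. 1 - fps_const (1 / real j) * fps_X :: real fps"
  have const: "(\<Prod>j\<in>A. fps_const (f j)) = fps_const (prod f A)" for A and f :: "nat \<Rightarrow> real"
    by (induction A rule: infinite_finite_induct) simp_all
  have nth_0: "fps_nth (\<Prod>j\<in>A. 1 - fps_const (c j) * fps_X) 0 = 1" for A and c :: "nat \<Rightarrow> real"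
    by (induction A rule: infinite_finite_induct) simp_all
  have "fps_of_poly (\<Prod>j=1..m. [:- real j, 1:]) = (\<Prod>j=1..m. fps_const (- real j) * (1 - fps_const (1 / real j) * fps_X))"
    unfolding fps_of_poly_prod
    by (intro prod.cong refl)
       (simp add: fps_of_poly_pCons right_diff_distrib mult.assoc[symmetric] fps_const_mult)
  also have "\<dots> = fps_const (\<Prod>j=1..m. - real j) * ?L"
    by (simp add: prod.distrib const)
  finally have "fps_of_poly (\<Prod>j=1..m. [:- real j, 1:]) = fps_const (\<Prod>j=1..m. - real j) * ?L" .
  moreover have "fps_nth ?L 0 \<noteq> 0" by (simp add: nth_0)
  then have "inv_tail m * ?L = 1" unfolding inv_tail_def by (rule inverse_mult_eq_1)
  ultimately show ?thesis by (simp add: mult_ac)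
qed

text \<open>Modulo \<open>x^(b+1)\<close> the series \<open>C\<close> inverts \<open>L\<close>,
  while \<open>V\<close> inverts \<open>L\<close> up to the factor \<open>K\<close>; inverses are
  unique.\<close>

lemma fps_nth_eq_if_mult_agrees:
  fixes C L V :: "real fps"
  assumes "L * V = fps_const K" and "\<And>i. i \<le> b \<Longrightarrow> fps_nth (C * L) i = (if i = 0 then 1 else 0)" and "i \<le> b"
  shows "K * fps_nth C i = fps_nth V i"
proof -
  have "K * fps_nth C i = fps_nth (C * fps_const K) i" by (simp add: mult.commute)
  also have "C * fps_const K = C * L * V" by (simp add: assms(1)[symmetric] mult.assoc)
  also have "fps_nth (C * L * V) i = (\<Sum>j=0..i. (if j = 0 then 1 else 0) * fps_nth V (i - j))"
    unfolding fps_mult_nth[of "C * L" V] using assms(2,3) by (intro sum.cong) auto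
  also have "\<dots> = (\<Sum>j=0..i. if j = 0 then fps_nth V (i - j) else 0)"
    by (intro sum.cong) auto
  also have "\<dots> = fps_nth V i" by simp
  finally show ?thesis .
qed

text \<open>The functional is \<open>f \<mapsto> Res (f / g ^ (b + 1))\<close> at infinity for \<open>g = \<Prod>a\<le>m. (x - a)\<close>, i.e. the
  top coefficient of \<open>f mod g ^ (b + 1)\<close>. Its part at 0 is found by testing it on
  \<open>x ^ r * (\<Prod>j=1..m. (x - j)) ^ (b + 1)\<close>, which have no jets at the other nodes.\<close>

lemma residue_dual_basic: "residue_dual m b (Suc m * b + m) (\<lambda>s. fps_nth (inv_tail m ^ Suc b) (b - s))"
proof -
  \<comment> \<open>\<open>B\<close> is \<open>g^(b+1)\<close>. The terms \<open>w a * R a\<close>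
    split 1 into one piece per node, each divisible by the powers at all other nodes.\<close>
  define p where "p a = [:- real a, 1:]" for a
  define B where "B = (\<Prod>a\<le>m. p a ^ Suc b)"
  define R where "R a = (\<Prod>c\<in>{..m} - {a}. p c ^ Suc b)" for a
  obtain w where w: "(\<Sum>a\<le>m. w a * R a) = 1"
    using bezout_linear_powers[of "{..m}" "Suc b"] by (auto simp: R_def p_def)
  have BR: "B = p a ^ Suc b * R a" if "a \<le> m" for a
    using that by (simp add: B_def R_def prod.remove)
  \<comment> \<open>\<open>M\<close> is \<open>degree B - 1\<close>, the largest degree a remainder
    modulo \<open>B\<close> can have.\<close>
  define M where "M = Suc m * b + m"
  have p_nz: "p a \<noteq> 0" "degree (p a) = 1" for a by (simp_all add: p_def)
  have degB: "degree B = Suc M"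
    unfolding B_def using p_nz
    by (subst degree_prod_eq_sum_degree) (simp_all add: degree_power_eq M_def del: power_Suc)
  define lam where "lam f = coeff (f mod B) M" for f
  have lam_add: "lam (f + g) = lam f + lam g" for f g by (simp add: lam_def poly_mod_add_left)
  have lam_smult: "lam (smult x f) = x * lam f" for x f by (simp add: lam_def mod_smult_left)
  have lam_0: "lam 0 = 0" by (simp add: lam_def)
  have lam_sum: "lam (sum h A) = (\<Sum>x\<in>A. lam (h x))" for h :: "nat \<Rightarrow> real poly" and A
    by (induction A rule: infinite_finite_induct) (simp_all add: lam_add lam_0)
  have lam_B: "lam (B * f) = 0" for f by (simp add: lam_def)
  have lam_low: "lam f = coeff f M" if "degree f < Suc M" for f
    using that degB by (simp add: lam_def mod_poly_less)
  define c where "c a s = lam (w a * R a * p a ^ s)" for a s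
  \<comment> \<open>Split \<open>f\<close> along the decomposition of 1 and expand it at each node
    by Taylor's formula. The Taylor remainder contributes a multiple of \<open>B\<close>, which
    \<open>lam\<close> kills.\<close>
  have jets: "lam f = (\<Sum>a\<le>m. \<Sum>s\<le>b. c a s * coeff (pcompose f [:real a, 1:]) s)" for f
  proof -
    have "lam f = lam (\<Sum>a\<le>m. w a * R a * f)"
      using w by (simp add: sum_distrib_right[symmetric])
    also have "\<dots> = (\<Sum>a\<le>m. lam (w a * R a * f))" by (rule lam_sum)
    also have "\<dots> = (\<Sum>a\<le>m. \<Sum>s\<le>b. c a s * coeff (pcompose f [:real a, 1:]) s)"
    proof (intro sum.cong refl)
      fix a assume a: "a \<in> {..m}"
      let ?F = "coeff (pcompose f [:real a, 1:])"
      obtain q where q: "f = (\<Sum>s\<le>b. smult (?F s) (p a ^ s)) + p a ^ Suc b * q"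
        unfolding p_def by (rule taylor_remainder)
      have "w a * R a * f = (\<Sum>s\<le>b. smult (?F s) (w a * R a * p a ^ s)) + B * (w a * q)"
        using BR[of a] a by (subst q) (simp add: algebra_simps sum_distrib_left)
      then show "lam (w a * R a * f) = (\<Sum>s\<le>b. c a s * ?F s)"
        by (simp only: lam_add lam_B lam_sum lam_smult c_def mult.commute[of "?F _"] add_0_right)
    qed
    finally show ?thesis .
  qed
  have shift_pow: "coeff (pcompose ([:0, 1:] ^ t) [:x, 1:]) s = real (t choose s) * x ^ (t - s)" for t s and x :: real
  proof (cases "s \<le> t")
    case True
    then show ?thesis by (simp add: pcompose_power pcompose_pCons coeff_linear_poly_power)
  next
    case False
    then show ?thesis
      by (simp add: pcompose_power pcompose_pCons binomial_eq_0 coeff_eq_0 degree_linear_power)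
  qed
  \<comment> \<open>For \<open>t < M\<close> the monomial \<open>x^t\<close> is its own remainder
    and has no \<open>x^M\<close> term.\<close>
  have vanish: "(\<Sum>a\<le>m. \<Sum>s\<le>b. c a s * (real (t choose s) * real a ^ (t - s))) = 0" if "t < M" for t
  proof -
    have "lam ([:0, 1:] ^ t) = 0"
      using that by (subst lam_low) (simp_all add: degree_linear_power coeff_eq_0)
    then show ?thesis by (simp add: jets shift_pow)
  qed
  \<comment> \<open>\<open>l\<close> collects the nonzero nodes, and \<open>K\<close> is the value
    of \<open>l^(b+1)\<close> at 0.\<close>
  define l where "l = (\<Prod>j=1..m. p j)"
  define K where "K = (\<Prod>j=1..m. - real j) ^ Suc b"
  have deg_l: "degree (l ^ Suc b) = m * Suc b" "lead_coeff (l ^ Suc b) = 1"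
  proof -
    have "l \<noteq> 0" "degree l = m" unfolding l_def using p_nz by (simp_all add: degree_prod_eq_sum_degree)
    then show "degree (l ^ Suc b) = m * Suc b" by (simp add: degree_power_eq del: power_Suc)
    show "lead_coeff (l ^ Suc b) = 1"
      by (simp only: l_def lead_coeff_power lead_coeff_prod) (simp add: p_def)
  qed
  \<comment> \<open>The factor \<open>l^(b+1)\<close> removes the jets at the nonzero nodes. The
    degree \<open>r + m(b+1)\<close> is at most \<open>M\<close>, with equality only for
    \<open>r = b\<close>, where the leading coefficient 1 is picked up.\<close>
  have zero_jet: "(\<Sum>s\<le>b. c 0 s * coeff (monom 1 r * l ^ Suc b) s) = (if r = b then 1 else 0)" if "r \<le> b" for r
  proof -
    let ?f = "monom 1 r * l ^ Suc b"
    have deg: "degree ?f = r + m * Suc b"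
      using deg_l by (subst degree_mult_eq) (auto simp: degree_monom_eq simp del: power_Suc)
    have "coeff (pcompose ?f [:real a, 1:]) s = 0" if "a \<in> {1..m}" "s \<le> b" for a s
    proof -
      have "p a dvd l" unfolding l_def using that by (intro dvd_prodI) auto
      then have "p a ^ Suc b dvd ?f" by (intro dvd_mult dvd_power_same)
      then show ?thesis
        using linear_power_dvd_iff_coeff_pcompose[of "real a" "Suc b" ?f] that by (auto simp: p_def less_Suc_eq_le)
    qed
    then have "lam ?f = (\<Sum>a\<le>m. if a = 0 then \<Sum>s\<le>b. c 0 s * coeff ?f s else 0)"
      unfolding jets by (intro sum.cong refl) auto
    also have "\<dots> = (\<Sum>s\<le>b. c 0 s * coeff ?f s)" by simp
    finally have 1: "lam ?f = (\<Sum>s\<le>b. c 0 s * coeff ?f s)" .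
    have "lam ?f = coeff ?f M" using deg that by (intro lam_low) (auto simp: M_def)
    also have "\<dots> = (if r = b then 1 else 0)"
    proof (cases "r = b")
      case True
      then have "M = r + degree (l ^ Suc b)" using deg_l by (simp add: M_def)
      then show ?thesis using True deg_l(2) by (simp add: coeff_monom_mult del: power_Suc)
    next
      case False
      then show ?thesis using that deg by (subst coeff_eq_0) (auto simp: M_def)
    qed
    finally show ?thesis using 1 by simp
  qed
  \<comment> \<open>Reversing the weights turns the triangular system \<open>zero_jet\<close> into a
    Cauchy product: \<open>C * l^(b+1)\<close> is 1 modulo \<open>x^(b+1)\<close>.\<close>
  define C where "C = Abs_fps (\<lambda>i. c 0 (b - i))"
  have CL: "fps_nth (C * fps_of_poly (l ^ Suc b)) i = (if i = 0 then 1 else 0)" if "i \<le> b" for i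
  proof -
    have "fps_nth (C * fps_of_poly (l ^ Suc b)) i = (\<Sum>j\<le>i. c 0 (b - j) * coeff (l ^ Suc b) (i - j))"
      by (simp add: fps_mult_nth C_def atLeast0AtMost del: power_Suc)
    also have "\<dots> = (\<Sum>s=b-i..b. c 0 s * coeff (l ^ Suc b) (s - (b - i)))"
      using that by (intro sum.reindex_bij_witness[of _ "\<lambda>s. b - s" "\<lambda>j. b - j"]) (auto simp: algebra_simps)
    also have "\<dots> = (\<Sum>s\<le>b. c 0 s * coeff (monom 1 (b - i) * l ^ Suc b) s)"
      by (intro sum.mono_neutral_cong_left) (auto simp: coeff_monom_mult simp del: power_Suc)
    also have "\<dots> = (if i = 0 then 1 else 0)"
      using that by (subst zero_jet) auto
    finally show ?thesis .
  qed
  have LV: "fps_of_poly (l ^ Suc b) * inv_tail m ^ Suc b = fps_const K"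
    unfolding K_def l_def p_def fps_of_poly_power power_mult_distrib[symmetric] mult.commute[of _ "inv_tail m"] inv_tail_mult
    by (rule fps_const_power)
  have c0: "K * c 0 s = fps_nth (inv_tail m ^ Suc b) (b - s)" if "s \<le> b" for s
    using fps_nth_eq_if_mult_agrees[OF LV CL, of b "b - s"] that by (simp add: C_def)
  show ?thesis unfolding residue_dual_def
  \<comment> \<open>Scaling all weights by \<open>K\<close> keeps the vanishing and clears the
    constant from the part at 0.\<close>
  proof (intro exI[of _ "\<lambda>a s. K * c a s"] conjI allI impI)
    fix t assume "t < Suc m * b + m"
    then show "(\<Sum>a\<le>m. \<Sum>s\<le>b. K * c a s * (real (t choose s) * real a ^ (t - s))) = 0"
      using vanish[of t] by (simp add: M_def sum_distrib_left[symmetric] mult.assoc)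
  qed (rule c0)
qed

text \<open>Precomposition with multiplication by \<open>x\<close>.\<close>

lemma residue_dual_shift:
  assumes "residue_dual m b d w"
  shows "residue_dual m b (d - 1) (\<lambda>s. if s < b then w (Suc s) else 0)"
proof -
  from assms obtain c where c0: "\<And>s. s \<le> b \<Longrightarrow> c 0 s = w s"
    and c: "\<And>t. t < d \<Longrightarrow> (\<Sum>a\<le>m. \<Sum>s\<le>b. c a s * (real (t choose s) * real a ^ (t - s))) = 0"
    unfolding residue_dual_def by auto
  \<comment> \<open>The order-\<open>s\<close> coefficient of \<open>x f\<close> at \<open>a\<close>
    is \<open>a f_s + f_(s-1)\<close>; collecting the terms in \<open>f_s\<close> gives
    \<open>c'\<close>. At \<open>a = 0\<close> only the index shift remains.\<close>
  define c' where "c' a s = real a * c a s + (if s < b then c a (Suc s) else 0)" for a s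
  have step: "(\<Sum>s\<le>b. c' a s * (real (t choose s) * real a ^ (t - s))) =
      (\<Sum>s\<le>b. c a s * (real (Suc t choose s) * real a ^ (Suc t - s)))" for a t
  proof -
    define N where "N s = real (t choose s) * real a ^ (t - s)" for s
    have N0: "real (Suc t choose 0) * real a ^ (Suc t - 0) = real a * N 0" by (simp add: N_def)
    \<comment> \<open>Pascal's rule. When \<open>t < Suc s\<close> the truncated exponent is
      harmless, since the binomial coefficient is 0.\<close>
    have NS: "real (Suc t choose Suc s) * real a ^ (Suc t - Suc s) = real a * N (Suc s) + N s" for s
      by (cases "Suc s \<le> t") (auto simp: N_def algebra_simps binomial_eq_0 Suc_diff_Suc simp flip: power_Suc)
    have "(\<Sum>s\<le>q. c a s * (real (Suc t choose s) * real a ^ (Suc t - s))) =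
        (\<Sum>s\<le>q. real a * c a s * N s) + (\<Sum>s<q. c a (Suc s) * N s)" for q
    proof (induction q)
      case (Suc q)
      then show ?case unfolding sum.atMost_Suc NS by (simp add: algebra_simps)
    qed (simp add: N0[simplified])
    from this[of b] have "(\<Sum>s\<le>b. c a s * (real (Suc t choose s) * real a ^ (Suc t - s))) =
        (\<Sum>s\<le>b. real a * c a s * N s) + (\<Sum>s\<le>b. if s < b then c a (Suc s) * N s else 0)"
      by (simp add: lessThan_Suc_atMost[symmetric])
    then show ?thesis
      by (simp add: c'_def N_def sum.distrib[symmetric] algebra_simps if_distrib[of "(*) _"] cong: if_cong)
  qed
  show ?thesis unfolding residue_dual_def
  proof (intro exI[of _ c'] conjI allI impI)
    fix t assume "t < d - 1"
    then show "(\<Sum>a\<le>m. \<Sum>s\<le>b. c' a s * (real (t choose s) * real a ^ (t - s))) = 0"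
      unfolding step by (intro c) simp
  next
    fix s assume "s \<le> b"
    then show "c' 0 s = (if s < b then w (Suc s) else 0)" by (simp add: c'_def c0)
  qed
qed

section \<open>Signs and low coefficients of the series \<open>inv_tail\<close> and its
  powers\<close>

lemma inv_tail_0 [simp]: "inv_tail 0 = 1" by (simp add: inv_tail_def)

lemma inv_tail_Suc: "inv_tail (Suc m) * (1 - fps_const (1 / real (Suc m)) * fps_X) = inv_tail m"
proof -
  let ?l = "1 - fps_const (1 / real (Suc m)) * fps_X :: real fps"
  have "inv_tail (Suc m) = inv_tail m * inverse ?l"
    by (simp add: inv_tail_def fps_inverse_mult)
  moreover have "inverse ?l * ?l = 1" by (rule inverse_mult_eq_1) simp
  ultimately show ?thesis by (simp add: mult.assoc)
qed

text \<open>Compare coefficients in \<open>inv_tail_Suc\<close>. The recursion only adds, which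
  gives nonnegativity, and each step in \<open>m\<close> adds a positive amount to the linear
  coefficient.\<close>

lemma inv_tail_nth_Suc:
  "fps_nth (inv_tail (Suc m)) 0 = fps_nth (inv_tail m) 0"
  "fps_nth (inv_tail (Suc m)) (Suc i) = fps_nth (inv_tail m) (Suc i) + fps_nth (inv_tail (Suc m)) i / real (Suc m)"
  by (simp_all add: inv_tail_Suc[of m, symmetric] right_diff_distrib mult.assoc[symmetric] mult.commute[of _ fps_X])

lemma inv_tail_nth_0 [simp]: "fps_nth (inv_tail m) 0 = 1"
  by (induction m) (simp_all add: inv_tail_nth_Suc)

lemma inv_tail_nth_nonneg: "0 \<le> fps_nth (inv_tail m) i"
proof (induction m arbitrary: i)
  case (Suc m)
  show ?case by (induction i) (simp_all add: inv_tail_nth_Suc Suc)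
qed simp

lemma inv_tail_nth_1_pos: "0 < m \<Longrightarrow> 0 < fps_nth (inv_tail m) 1"
proof -
  assume "0 < m"
  then obtain q where "m = Suc q" by (cases m) auto
  then show ?thesis using inv_tail_nth_nonneg[of q 1] by (simp add: inv_tail_nth_Suc add_nonneg_pos)
qed

text \<open>The explicit systems for \<open>k \<le> 4\<close> involve powers of \<open>E\<close>
  only through order 2.\<close>

lemma fps_power_nth_1_2:
  fixes E :: "real fps"
  assumes "fps_nth E 0 = 1"
  shows "fps_nth (E ^ N) 1 = N * fps_nth E 1"
    "fps_nth (E ^ N) 2 = N * fps_nth E 2 + real (N choose 2) * (fps_nth E 1)\<^sup>2"
proof -
  have 0: "fps_nth (E ^ N) 0 = 1" for N using assms by (simp add: fps_power_zeroth)
  show 1: "fps_nth (E ^ N) 1 = N * fps_nth E 1" for N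
    by (induction N) (simp_all add: fps_mult_nth_1 assms 0 algebra_simps)
  show "fps_nth (E ^ N) 2 = N * fps_nth E 2 + real (N choose 2) * (fps_nth E 1)\<^sup>2"
  proof (induction N)
    case (Suc N)
    have "Suc N choose 2 = (N choose 2) + N" by (simp add: numeral_2_eq_2)
    then show ?case
      using Suc 1[of N] 0[of N] assms
      by (simp add: fps_mult_nth numeral_2_eq_2 algebra_simps power2_eq_square)
  qed simp
qed

section \<open>Linear conditions on the jet at the origin\<close>

text \<open>Apply the tensor product of the univariate functionals to \<open>P\<close>. By degree it
  kills every monomial of \<open>P\<close>. Expanded into jets at grid points, only the origin can
  contribute, because the jets have total order below \<open>k\<close>.\<close>

lemma residue_identity:
  assumes vars: "in_vars n P" and zeros: "\<forall>a\<in>grid m n - {(\<lambda>_. 0)}. mult_ge P a k"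
    and dual: "\<And>i. i < n \<Longrightarrow> residue_dual m (b i) (d i) (w i)"
    and order: "(\<Sum>i<n. b i) < k" and deg: "total_deg P < (\<Sum>i<n. d i)"
  shows "(\<Sum>s\<in>PiE {..<n} (\<lambda>i. {..b i}). (\<Prod>i<n. w i (s i)) * Poly_Mapping.lookup P (mon_of {..<n} s)) = 0"
proof -
  let ?K = "Poly_Mapping.keys P" and ?P = "Poly_Mapping.lookup P"
  define L where "L \<alpha> = Poly_Mapping.lookup \<alpha>" for \<alpha> :: "nat \<Rightarrow>\<^sub>0 nat"
  let ?G = "PiE {..<n} (\<lambda>i. {..m})" and ?B = "PiE {..<n} (\<lambda>i. {..b i})"
  have "\<forall>i. \<exists>c. i < n \<longrightarrow>
     (\<forall>t<d i. (\<Sum>a\<le>m. \<Sum>s\<le>b i. c a s * (real (t choose s) * real a ^ (t - s))) = 0) \<and>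
     (\<forall>s\<le>b i. c 0 s = w i s)"
    using dual unfolding residue_dual_def by blast
  then have "\<exists>c. \<forall>i. i < n \<longrightarrow>
     (\<forall>t<d i. (\<Sum>a\<le>m. \<Sum>s\<le>b i. c i a s * (real (t choose s) * real a ^ (t - s))) = 0) \<and>
     (\<forall>s\<le>b i. c i 0 s = w i s)"
    by (rule choice)
  then obtain c where c: "\<And>i t. i < n \<Longrightarrow> t < d i \<Longrightarrow>
        (\<Sum>a\<le>m. \<Sum>s\<le>b i. c i a s * (real (t choose s) * real a ^ (t - s))) = 0"
      and c0: "\<And>i s. i < n \<Longrightarrow> s \<le> b i \<Longrightarrow> c i 0 s = w i s"
    by blast
  have keys_sub: "Poly_Mapping.keys \<alpha> \<subseteq> {..<n}" if "\<alpha> \<in> ?K" for \<alpha>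
    using vars that by (auto simp: in_vars_def)
  \<comment> \<open>Extension by 0 outside \<open>{..<n}\<close>, as \<open>grid\<close>
    demands.\<close>
  define pt where "pt a i = (if i < n then real (a i) else 0)" for a :: "nat \<Rightarrow> nat" and i
  \<comment> \<open>By pigeonhole some exponent lies below its threshold \<open>d i\<close>, and the
    corresponding factor is 0.\<close>
  have van: "(\<Prod>i<n. \<Sum>a\<le>m. \<Sum>s\<le>b i. c i a s * (real (L \<alpha> i choose s) * real a ^ (L \<alpha> i - s))) = 0"
    if "\<alpha> \<in> ?K" for \<alpha>
  proof -
    have "(\<Sum>i<n. L \<alpha> i) < (\<Sum>i<n. d i)"
      using mon_deg_le_total_deg[OF that] deg keys_sub[OF that] by (simp add: mon_deg_eq_sum[of "{..<n}"] L_def)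
    then obtain i where "i < n" "L \<alpha> i < d i"
      by (meson lessThan_iff not_le sum_mono)
    then show ?thesis using c by (intro prod_zero) auto
  qed
  have "0 = (\<Sum>\<alpha>\<in>?K. ?P \<alpha> *
      (\<Prod>i<n. \<Sum>a\<le>m. \<Sum>s\<le>b i. c i a s * (real (L \<alpha> i choose s) * real a ^ (L \<alpha> i - s))))"
    by (intro sum.neutral[symmetric] ballI) (simp only: van mult_zero_right)
  also have "\<dots> = (\<Sum>\<alpha>\<in>?K. ?P \<alpha> * (\<Sum>a\<in>?G. \<Sum>s\<in>?B.
      \<Prod>i<n. c i (a i) (s i) * (real (L \<alpha> i choose s i) * real (a i) ^ (L \<alpha> i - s i))))"
    by (simp add: prod_sum_PiE)
  also have "\<dots> = (\<Sum>\<alpha>\<in>?K. \<Sum>a\<in>?G. \<Sum>s\<in>?B. (\<Prod>i<n. c i (a i) (s i)) *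
      (?P \<alpha> * (\<Prod>i<n. real (L \<alpha> i choose s i) * real (a i) ^ (L \<alpha> i - s i))))"
    by (simp add: sum_distrib_left prod.distrib mult_ac)
  \<comment> \<open>With the sum over monomials innermost, each inner sum becomes a coefficient of
    the shifted polynomial.\<close>
  also have "\<dots> = (\<Sum>a\<in>?G. \<Sum>s\<in>?B. \<Sum>\<alpha>\<in>?K. (\<Prod>i<n. c i (a i) (s i)) *
      (?P \<alpha> * (\<Prod>i<n. real (L \<alpha> i choose s i) * real (a i) ^ (L \<alpha> i - s i))))"
    by (subst sum.swap, intro sum.cong refl, subst sum.swap, rule refl)
  also have "\<dots> = (\<Sum>a\<in>?G. \<Sum>s\<in>?B. (\<Prod>i<n. c i (a i) (s i)) *
      Poly_Mapping.lookup (shift P (pt a)) (mon_of {..<n} s))"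
    using keys_sub
    by (subst lookup_shift[of "{..<n}"])
       (auto simp: keys_mon_of lookup_mon_of pt_def L_def sum_distrib_left)
  also have "\<dots> = (\<Sum>a\<in>?G. if a = (\<lambda>i\<in>{..<n}. 0) then
      (\<Sum>s\<in>?B. (\<Prod>i<n. w i (s i)) * ?P (mon_of {..<n} s)) else 0)"
  proof (intro sum.cong refl)
    fix a assume a: "a \<in> ?G"
    show "(\<Sum>s\<in>?B. (\<Prod>i<n. c i (a i) (s i)) * Poly_Mapping.lookup (shift P (pt a)) (mon_of {..<n} s)) =
      (if a = (\<lambda>i\<in>{..<n}. 0) then (\<Sum>s\<in>?B. (\<Prod>i<n. w i (s i)) * ?P (mon_of {..<n} s)) else 0)"
    proof (cases "a = (\<lambda>i\<in>{..<n}. 0)")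
      case True
      have "pt a = (\<lambda>_. 0)" using True by (auto simp: pt_def)
      moreover have "(\<Prod>i<n. c i (a i) (s i)) = (\<Prod>i<n. w i (s i))" if "s \<in> ?B" for s
        using that True c0 by (intro prod.cong) auto
      ultimately show ?thesis using True by simp
    next
      case False
      have "pt a \<noteq> (\<lambda>_. 0)"
      proof
        assume "pt a = (\<lambda>_. 0)"
        then have "a i = 0" if "i < n" for i using that by (auto simp: pt_def fun_eq_iff split: if_splits)
        then show False using False a by (auto simp: fun_eq_iff PiE_def extensional_def restrict_def split: if_splits)
      qed
      moreover have "pt a \<in> grid m n" using a by (auto simp: grid_def pt_def PiE_iff)
      ultimately have ge: "mult_ge P (pt a) k" using zeros by blast
      have "Poly_Mapping.lookup (shift P (pt a)) (mon_of {..<n} s) = 0" if "s \<in> ?B" for s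
      proof -
        have "(\<Sum>i<n. s i) \<le> (\<Sum>i<n. b i)" using that by (intro sum_mono) (auto simp: PiE_def)
        then have "mon_deg (mon_of {..<n} s) < k" using order by (simp add: mon_deg_mon_of)
        then show ?thesis using ge unfolding mult_ge_def by (metis in_keys_iff not_le)
      qed
      then show ?thesis using False by simp
    qed
  qed
  also have "\<dots> = (\<Sum>s\<in>?B. (\<Prod>i<n. w i (s i)) * ?P (mon_of {..<n} s))"
    by (simp add: finite_PiE)
  finally show ?thesis by simp
qed

text \<open>The flag \<open>\<sigma>\<close> selects the functional precomposed with multiplication by \<open>x\<close>.\<close>

definition dual_weight :: "nat \<Rightarrow> bool \<Rightarrow> nat \<Rightarrow> nat \<Rightarrow> real" where
  "dual_weight m \<sigma> b s = (if \<sigma> then if s < b then fps_nth (inv_tail m ^ Suc b) (b - Suc s) else 0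
     else fps_nth (inv_tail m ^ Suc b) (b - s))"

lemma residue_dual_weight:
  "residue_dual m b (Suc m * b + m - (if \<sigma> then 1 else 0)) (dual_weight m \<sigma> b)"
proof (cases \<sigma>)
  case True
  then show ?thesis
    using residue_dual_shift[OF residue_dual_basic[of m b]] by (simp add: dual_weight_def[abs_def])
next
  case False
  then show ?thesis using residue_dual_basic[of m b] by (simp add: dual_weight_def[abs_def])
qed

text \<open>\<open>E\<close> has constant term 1, so the top weight is 1. Multiplication by
  \<open>x\<close> moves it one order down and leaves weight 0 at order \<open>b\<close>.\<close>

lemma dual_weight_top: "dual_weight m False b b = 1" "dual_weight m True (Suc b) b = 1" "dual_weight m True b b = 0"
  by (simp_all add: dual_weight_def fps_power_zeroth)

text \<open>The thresholds add up to \<open>m n + (m + 1)(k - 1)\<close> minus the number of flagged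
  variables: each multiplication by a variable costs one degree.\<close>

lemma residue_identity_weight:
  assumes vars: "in_vars n P" and zeros: "\<forall>a\<in>grid m n - {(\<lambda>_. 0)}. mult_ge P a k"
    and order: "Suc (\<Sum>i<n. b i) = k"
    and deg: "total_deg P + card {i. i < n \<and> \<sigma> i} < m * n + Suc m * (k - 1)" and m: "0 < m"
  shows "(\<Sum>s\<in>PiE {..<n} (\<lambda>i. {..b i}). (\<Prod>i<n. dual_weight m (\<sigma> i) (b i) (s i)) * Poly_Mapping.lookup P (mon_of {..<n} s)) = 0"
proof (rule residue_identity[OF vars zeros residue_dual_weight])
  show "(\<Sum>i<n. b i) < k" using order by simp
  \<comment> \<open>\<open>0 < m\<close> keeps the subtraction from truncating when
    \<open>b i = 0\<close>.\<close>
  have "(\<Sum>i<n. Suc m * b i + m) = (\<Sum>i<n. (Suc m * b i + m - (if \<sigma> i then 1 else 0)) + (if \<sigma> i then 1 else 0))"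
    using m by (intro sum.cong refl) auto
  also have "\<dots> = (\<Sum>i<n. Suc m * b i + m - (if \<sigma> i then 1 else 0)) + card {i. i < n \<and> \<sigma> i}"
    by (simp add: sum.distrib sum.If_cases Int_def)
  finally have *: "(\<Sum>i<n. Suc m * b i + m) = (\<Sum>i<n. Suc m * b i + m - (if \<sigma> i then 1 else 0)) + card {i. i < n \<and> \<sigma> i}" .
  have "(\<Sum>i<n. Suc m * b i + m) = Suc m * (\<Sum>i<n. b i) + m * n"
    by (simp only: sum.distrib sum_distrib_left[symmetric]) simp
  also have "(\<Sum>i<n. b i) = k - 1" using order by simp
  finally have "(\<Sum>i<n. Suc m * b i + m) = Suc m * (k - 1) + m * n" .
  with * deg show "total_deg P < (\<Sum>i<n. Suc m * b i + m - (if \<sigma> i then 1 else 0))" by linarith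
qed

text \<open>Adding the flags to \<open>\<alpha>\<close> gives \<open>b\<close>, for which
  \<open>\<alpha>\<close> has weight 1. Any other exponent in the box either exceeds
  \<open>\<alpha>\<close> in a flagged coordinate, where the weight is 0, or has smaller degree,
  where \<open>P\<close> has no coefficient by \<open>low\<close>.\<close>

lemma top_coefficient_zero:
  assumes vars: "in_vars n P" and zeros: "\<forall>a\<in>grid m n - {(\<lambda>_. 0)}. mult_ge P a k"
    and order: "Suc (\<Sum>i<n. \<alpha> i + (if \<sigma> i then 1 else 0)) = k"
    and deg: "total_deg P + card {i. i < n \<and> \<sigma> i} < m * n + Suc m * (k - 1)" and m: "0 < m"
    and low: "mult_ge P (\<lambda>_. 0) (\<Sum>i<n. \<alpha> i)"
  shows "Poly_Mapping.lookup P (mon_of {..<n} \<alpha>) = 0"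
proof -
  define b where "b i = \<alpha> i + (if \<sigma> i then 1 else 0)" for i
  let ?B = "PiE {..<n} (\<lambda>i. {..b i})"
  let ?r = "restrict \<alpha> {..<n}"
  have mr: "mon_of {..<n} ?r = mon_of {..<n} \<alpha>" by (simp add: mon_of_def)
  have "0 = (\<Sum>s\<in>?B. (\<Prod>i<n. dual_weight m (\<sigma> i) (b i) (s i)) * Poly_Mapping.lookup P (mon_of {..<n} s))"
    using residue_identity_weight[OF vars zeros _ deg m, of b] order by (simp add: b_def)
  also have "\<dots> = (\<Sum>s\<in>?B. if s = ?r then Poly_Mapping.lookup P (mon_of {..<n} \<alpha>) else 0)"
  proof (intro sum.cong refl)
    fix s assume s: "s \<in> ?B"
    show "(\<Prod>i<n. dual_weight m (\<sigma> i) (b i) (s i)) * Poly_Mapping.lookup P (mon_of {..<n} s) =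
        (if s = ?r then Poly_Mapping.lookup P (mon_of {..<n} \<alpha>) else 0)"
    proof (cases "s = ?r")
      case True
      have "dual_weight m (\<sigma> i) (b i) (s i) = 1" if "i < n" for i
        using that True by (cases "\<sigma> i") (simp_all add: b_def dual_weight_top)
      then show ?thesis using True mr by simp
    next
      case False
      show ?thesis
      proof (cases "\<exists>i<n. \<alpha> i < s i")
        case True
        then obtain i where i: "i < n" "\<alpha> i < s i" by blast
        then have "\<sigma> i" "s i = b i" using s by (auto simp: b_def PiE_iff split: if_splits) (metis lessThan_iff le_antisym Suc_leI)+
        then have "dual_weight m (\<sigma> i) (b i) (s i) = 0" by (simp add: dual_weight_top)
        then have "(\<Prod>i<n. dual_weight m (\<sigma> i) (b i) (s i)) = 0" using i by (intro prod_zero) auto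
        then show ?thesis using False by simp
      next
        case le: False
        have ex: "\<exists>i<n. s i \<noteq> \<alpha> i"
          using False s by (auto simp: fun_eq_iff PiE_iff extensional_def restrict_def split: if_splits)
        have "(\<Sum>i<n. s i) < (\<Sum>i<n. \<alpha> i)"
        proof (rule sum_strict_mono_ex1)
          show "\<forall>i\<in>{..<n}. s i \<le> \<alpha> i" using le by (meson lessThan_iff not_le)
          show "\<exists>i\<in>{..<n}. s i < \<alpha> i" using ex le by (meson lessThan_iff linorder_neqE_nat)
        qed simp
        then have "mon_deg (mon_of {..<n} s) < (\<Sum>i<n. \<alpha> i)" by (simp add: mon_deg_mon_of)
        then have "Poly_Mapping.lookup P (mon_of {..<n} s) = 0"
          using low unfolding mult_ge_def shift_zero by (metis in_keys_iff not_le)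
        then show ?thesis using False by simp
      qed
    qed
  qed
  also have "\<dots> = Poly_Mapping.lookup P (mon_of {..<n} \<alpha>)"
  proof -
    have "?r \<in> ?B" by (auto simp: b_def)
    then show ?thesis by (simp add: finite_PiE)
  qed
  finally show ?thesis by simp
qed

lemma mult_ge_0_Suc:
  assumes "in_vars n P" "mult_ge P (\<lambda>_. 0) j"
    and "\<And>\<alpha>. (\<Sum>i<n. \<alpha> i) = j \<Longrightarrow> Poly_Mapping.lookup P (mon_of {..<n} \<alpha>) = 0"
  shows "mult_ge P (\<lambda>_. 0) (Suc j)"
  unfolding mult_ge_def shift_zero
proof
  fix \<alpha> assume \<alpha>: "\<alpha> \<in> Poly_Mapping.keys P"
  then have sub: "Poly_Mapping.keys \<alpha> \<subseteq> {..<n}" using assms(1) by (auto simp: in_vars_def)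
  then have "mon_deg \<alpha> \<noteq> j"
    using assms(3)[of "Poly_Mapping.lookup \<alpha>"] \<alpha> by (auto simp: mon_deg_eq_sum[of "{..<n}"] mon_of_lookup in_keys_iff)
  moreover have "j \<le> mon_deg \<alpha>" using assms(2) \<alpha> by (simp add: mult_ge_def)
  ultimately show "Suc j \<le> mon_deg \<alpha>" by simp
qed

text \<open>Uses \<open>top_coefficient_zero\<close> without flags. With \<open>j = k - 1\<close> it
  excludes multiplicity exactly \<open>k - 1\<close> below the bound of (i).\<close>

lemma mult_ge_0_bootstrap:
  assumes vars: "in_vars n P" and zeros: "\<forall>a\<in>grid m n - {(\<lambda>_. 0)}. mult_ge P a (Suc j)"
    and m: "0 < m" and "total_deg P < m * n + Suc m * j" and "mult_ge P (\<lambda>_. 0) j"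
  shows "mult_ge P (\<lambda>_. 0) (Suc j)"
  using vars assms(5)
proof (rule mult_ge_0_Suc)
  fix \<alpha> :: "nat \<Rightarrow> nat" assume "(\<Sum>i<n. \<alpha> i) = j"
  then show "Poly_Mapping.lookup P (mon_of {..<n} \<alpha>) = 0"
    using assms by (intro top_coefficient_zero[OF vars zeros, of _ "\<lambda>_. False"]) auto
qed

text \<open>A flag on variable 0 lowers the order of the determined coefficients by one at the cost
  of one degree. This lifts multiplicity \<open>k - 2\<close> to \<open>k - 1\<close>.\<close>

lemma mult_ge_0_bootstrap_shifted:
  assumes vars: "in_vars n P" and zeros: "\<forall>a\<in>grid m n - {(\<lambda>_. 0)}. mult_ge P a (Suc (Suc j))"
    and m: "0 < m" and "0 < n" and "total_deg P + 1 < m * n + Suc m * Suc j" and "mult_ge P (\<lambda>_. 0) j"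
  shows "mult_ge P (\<lambda>_. 0) (Suc j)"
  using vars assms(6)
proof (rule mult_ge_0_Suc)
  fix \<alpha> :: "nat \<Rightarrow> nat" assume "(\<Sum>i<n. \<alpha> i) = j"
  moreover have "{i. i < n \<and> i = 0} = {0}" using \<open>0 < n\<close> by auto
  ultimately show "Poly_Mapping.lookup P (mon_of {..<n} \<alpha>) = 0"
    using assms by (intro top_coefficient_zero[OF vars zeros, of _ "\<lambda>i. i = 0"]) (auto simp: sum.distrib)
qed

section \<open>Identities in few variables and the resulting linear systems\<close>

lemma sum_PiE_insert:
  assumes "x \<notin> S"
  shows "(\<Sum>s\<in>PiE (insert x S) B. F s) = (\<Sum>y\<in>B x. \<Sum>s\<in>PiE S B. F (s(x := y)))"
proof -
  have "(\<Sum>s\<in>PiE (insert x S) B. F s) = (\<Sum>(y, s)\<in>B x \<times> PiE S B. F (s(x := y)))"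
    unfolding PiE_insert_eq using inj_combinator[OF assms]
    by (subst sum.reindex) (auto simp: case_prod_unfold o_def)
  then show ?thesis by (simp add: sum.cartesian_product)
qed

text \<open>Taking \<open>b i = 0\<close> off \<open>S\<close> leaves only exponent 0 there, with
  weight 1, so just the variables of \<open>S\<close> appear. The flagged variable is
  \<open>p\<close>.\<close>

lemma residue_identity_on:
  assumes vars: "in_vars n P" and zeros: "\<forall>a\<in>grid m n - {(\<lambda>_. 0)}. mult_ge P a k" and m: "0 < m"
    and S: "S \<subseteq> {..<n}" and order: "Suc (\<Sum>i\<in>S. b i) = k"
    and deg: "total_deg P + 1 < m * n + Suc m * (k - 1)" and p: "p \<in> S"
  shows "(\<Sum>s\<in>PiE S (\<lambda>i. {..b i}). (\<Prod>i\<in>S. dual_weight m (i = p) (b i) (s i)) * Poly_Mapping.lookup P (mon_of S s)) = 0"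
proof -
  define b' where "b' i = (if i \<in> S then b i else 0)" for i
  have "card {i. i < n \<and> i = p} = 1"
  proof -
    have "{i. i < n \<and> i = p} = {p}" using p S by auto
    then show ?thesis by simp
  qed
  moreover have "(\<Sum>i<n. b' i) = (\<Sum>i\<in>S. b i)"
    unfolding b'_def using S by (intro sum.mono_neutral_cong_right) auto
  ultimately have "0 = (\<Sum>s\<in>PiE {..<n} (\<lambda>i. {..b' i}). (\<Prod>i<n. dual_weight m (i = p) (b' i) (s i)) * Poly_Mapping.lookup P (mon_of {..<n} s))"
    using residue_identity_weight[OF vars zeros _ _ m, of b' "\<lambda>i. i = p"] order deg by simp
  also have "\<dots> = (\<Sum>s\<in>PiE S (\<lambda>i. {..b i}). (\<Prod>i\<in>S. dual_weight m (i = p) (b i) (s i)) * Poly_Mapping.lookup P (mon_of S s))"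
  proof (rule sum.reindex_bij_witness[of _ "\<lambda>s. \<lambda>i\<in>{..<n}. if i \<in> S then s i else 0" "\<lambda>s. restrict s S"])
    fix s assume s: "s \<in> PiE {..<n} (\<lambda>i. {..b' i})"
    have z: "s i = 0" if "i < n" "i \<notin> S" for i using s that by (auto simp: b'_def PiE_iff dest!: bspec[of _ _ i])
    show "(\<lambda>i\<in>{..<n}. if i \<in> S then restrict s S i else 0) = s"
      using s z by (auto simp: fun_eq_iff PiE_iff extensional_def restrict_def)
    show "restrict s S \<in> PiE S (\<lambda>i. {..b i})"
    proof (intro restrict_PiE_iff[THEN iffD2] ballI)
      fix i assume "i \<in> S"
      then show "s i \<in> {..b i}" using PiE_mem[OF s, of i] S by (auto simp: b'_def)
    qed
    have "mon_of {..<n} s = mon_of S (restrict s S)"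
      unfolding mon_of_def using S z by (intro sum.mono_neutral_cong_right) auto
    moreover have "(\<Prod>i<n. dual_weight m (i = p) (b' i) (s i)) = (\<Prod>i\<in>S. dual_weight m (i = p) (b i) (restrict s S i))"
    proof (rule prod.mono_neutral_cong_right)
      show "\<forall>i\<in>{..<n} - S. dual_weight m (i = p) (b' i) (s i) = 1"
      proof
        fix i assume "i \<in> {..<n} - S"
        then have "i \<noteq> p" "b' i = 0" "s i = 0" using p z by (auto simp: b'_def)
        then show "dual_weight m (i = p) (b' i) (s i) = 1" by (simp add: dual_weight_top)
      qed
    qed (use S in \<open>auto simp: b'_def\<close>)
    ultimately show "(\<Prod>i\<in>S. dual_weight m (i = p) (b i) (restrict s S i)) * Poly_Mapping.lookup P (mon_of S (restrict s S)) =
      (\<Prod>i<n. dual_weight m (i = p) (b' i) (s i)) * Poly_Mapping.lookup P (mon_of {..<n} s)" by simp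
  next
    fix s assume s: "s \<in> PiE S (\<lambda>i. {..b i})"
    show "restrict (\<lambda>i\<in>{..<n}. if i \<in> S then s i else 0) S = s"
      using s S by (auto simp: fun_eq_iff PiE_iff extensional_def restrict_def)
    show "(\<lambda>i\<in>{..<n}. if i \<in> S then s i else 0) \<in> PiE {..<n} (\<lambda>i. {..b' i})"
      using s by (auto simp: PiE_iff b'_def)
  qed
  finally show ?thesis by simp
qed

lemma residue_identity_two:
  assumes "in_vars n P" "\<forall>a\<in>grid m n - {(\<lambda>_. 0)}. mult_ge P a k" "0 < m"
    and "p < n" "q < n" "p \<noteq> q" "Suc (b1 + b2) = k"
    and "total_deg P + 1 < m * n + Suc m * (k - 1)"
  shows "(\<Sum>x\<le>b1. \<Sum>y\<le>b2. dual_weight m True b1 x * dual_weight m False b2 y *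
    Poly_Mapping.lookup P (Poly_Mapping.single p x + Poly_Mapping.single q y)) = 0"
  using residue_identity_on[OF assms(1-3), of "{p, q}" "(\<lambda>_. 0)(p := b1, q := b2)" p] assms(4-)
  by (simp add: sum_PiE_insert mon_of_def)

lemma residue_identity_three:
  assumes "in_vars n P" "\<forall>a\<in>grid m n - {(\<lambda>_. 0)}. mult_ge P a k" "0 < m"
    and "p < n" "q < n" "r < n" "p \<noteq> q" "p \<noteq> r" "q \<noteq> r" "Suc (b1 + b2 + b3) = k"
    and "total_deg P + 1 < m * n + Suc m * (k - 1)"
  shows "(\<Sum>x\<le>b1. \<Sum>y\<le>b2. \<Sum>z\<le>b3. dual_weight m True b1 x * dual_weight m False b2 y * dual_weight m False b3 z *
    Poly_Mapping.lookup P (Poly_Mapping.single p x + Poly_Mapping.single q y + Poly_Mapping.single r z)) = 0"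
  using residue_identity_on[OF assms(1-3), of "{p, q, r}" "(\<lambda>_. 0)(p := b1, q := b2, r := b3)" p] assms(4-)
  by (simp add: sum_PiE_insert mon_of_def add_ac mult_ac)

text \<open>These are coefficients of orders 1 and 2 of \<open>E^2\<close>, \<open>E^3\<close> and
  \<open>E^4\<close>.\<close>

lemma dual_weight_values:
  fixes m :: nat
  defines "e1 \<equiv> fps_nth (inv_tail m) 1" and "e2 \<equiv> fps_nth (inv_tail m) 2"
  shows "dual_weight m False 1 0 = 2 * e1"
    and "dual_weight m False 2 0 = 3 * e2 + 3 * e1\<^sup>2" "dual_weight m False 2 1 = 3 * e1"
    and "dual_weight m True 2 0 = 3 * e1"
    and "dual_weight m True 3 0 = 4 * e2 + 6 * e1\<^sup>2" "dual_weight m True 3 1 = 4 * e1"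
proof -
  note E = fps_power_nth_1_2[OF inv_tail_nth_0[of m]]
  have ch: "3 choose 2 = (3::nat)" "4 choose 2 = (6::nat)" by (simp_all add: choose_two)
  show "dual_weight m False 1 0 = 2 * e1" "dual_weight m False 2 0 = 3 * e2 + 3 * e1\<^sup>2"
    "dual_weight m False 2 1 = 3 * e1" "dual_weight m True 2 0 = 3 * e1"
    "dual_weight m True 3 0 = 4 * e2 + 6 * e1\<^sup>2" "dual_weight m True 3 1 = 4 * e1"
    using E[of 2] E[of 3] E[of 4]
    by (simp_all add: dual_weight_def e1_def e2_def ch eval_nat_numeral del: power_Suc)
qed

lemma dual_weight_top_numeral:
  "dual_weight m False 0 0 = 1" "dual_weight m False 1 1 = 1" "dual_weight m False 2 2 = 1"
  "dual_weight m True 1 0 = 1" "dual_weight m True 2 1 = 1" "dual_weight m True 3 2 = 1"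
  "dual_weight m True 1 1 = 0" "dual_weight m True 2 2 = 0" "dual_weight m True 3 3 = 0"
  using dual_weight_top(2)[of m 0] dual_weight_top(2)[of m 1] dual_weight_top(2)[of m 2]
  by (simp_all add: dual_weight_top eval_nat_numeral)

lemma sum_atMost_numeral:
  "(\<Sum>x\<le>1. f x) = f 0 + f 1" "(\<Sum>x\<le>2. f x) = f 0 + f 1 + f 2" "(\<Sum>x\<le>3. f x) = f 0 + f 1 + f 2 + f 3"
  for f :: "nat \<Rightarrow> real"
  by (simp_all add: eval_nat_numeral)

text \<open>The functionals of order \<open>x_0^2\<close> flagged at \<open>x_0\<close> and of order
  \<open>x_0 x_1\<close> flagged at \<open>x_1\<close> are both led by the coefficient of
  \<open>x_0\<close>, but carry different multiples of the constant term. Their difference is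
  \<open>e1 * f0\<close>, and \<open>e1 > 0\<close>.\<close>

lemma const_zero_three:
  assumes vars: "in_vars n P" and zeros: "\<forall>a\<in>grid m n - {(\<lambda>_. 0)}. mult_ge P a 3"
    and m: "0 < m" and n: "2 \<le> n" and deg: "total_deg P + 1 < m * n + Suc m * 2"
  shows "Poly_Mapping.lookup P 0 = 0"
proof -
  define e1 where "e1 = fps_nth (inv_tail m) 1"
  note w = dual_weight_values[of m, folded e1_def] dual_weight_top_numeral
  note two = residue_identity_two[OF vars zeros m]
  let ?f0 = "Poly_Mapping.lookup P 0" and ?f1 = "Poly_Mapping.lookup P (Poly_Mapping.single 0 1)"
  have "?f1 + 3 * e1 * ?f0 = 0"
    using two[of 0 1 2 0] n deg by (simp add: sum_atMost_numeral w del: One_nat_def)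
  moreover have "?f1 + 2 * e1 * ?f0 = 0"
    using two[of 1 0 1 1] n deg by (simp add: sum_atMost_numeral w del: One_nat_def)
  ultimately have "e1 * ?f0 = 0" by linarith
  then show ?thesis using inv_tail_nth_1_pos[OF m] by (simp add: e1_def)
qed

text \<open>Two pairs of identities, each with a common leading coefficient. The first difference
  expresses \<open>fq\<close> through \<open>f0\<close>; the second then gives \<open>f0\<close>
  times the positive number \<open>e2 + e1^2\<close>. Three distinct variables are available since
  \<open>3 \<le> n\<close>.\<close>

lemma jet_zero_four:
  assumes vars: "in_vars n P" and zeros: "\<forall>a\<in>grid m n - {(\<lambda>_. 0)}. mult_ge P a 4"
    and m: "0 < m" and n: "3 \<le> n" and deg: "total_deg P + 1 < m * n + Suc m * 3" and q: "q < n"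
  shows "Poly_Mapping.lookup P 0 = 0" "Poly_Mapping.lookup P (Poly_Mapping.single q 1) = 0"
proof -
  define e1 e2 where "e1 = fps_nth (inv_tail m) 1" and "e2 = fps_nth (inv_tail m) 2"
  have e: "0 < e1" "0 \<le> e2" using inv_tail_nth_1_pos[OF m] inv_tail_nth_nonneg by (simp_all add: e1_def e2_def)
  note w = dual_weight_values[of m, folded e1_def e2_def] dual_weight_top_numeral
  note two = residue_identity_two[OF vars zeros m]
  obtain p r where pr: "p < n" "r < n" "p \<noteq> q" "r \<noteq> q" "p \<noteq> r"
  proof -
    consider "q = 0" | "q = 1" | "q \<ge> 2" by linarith
    then show ?thesis using that[of 1 2] that[of 0 2] that[of 0 1] n by cases auto
  qed
  let ?P = "Poly_Mapping.lookup P"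
  define f0 fp fq fpq fqq where "f0 = ?P 0" and "fp = ?P (Poly_Mapping.single p 1)"
    and "fq = ?P (Poly_Mapping.single q 1)" and "fpq = ?P (Poly_Mapping.single p 1 + Poly_Mapping.single q 1)"
    and "fqq = ?P (Poly_Mapping.single q 2)"
  note f = this
  \<comment> \<open>Orders \<open>x_r x_p x_q\<close> flagged at \<open>r\<close> and
    \<open>x_p^2 x_q\<close> flagged at \<open>p\<close>, both led by
    \<open>x_p x_q\<close>.\<close>
  have "fpq + 2 * e1 * fp + 2 * e1 * fq + 4 * e1\<^sup>2 * f0 = 0"
    using residue_identity_three[OF vars zeros m, of r p q 1 1 1] pr q deg
    by (simp add: sum_atMost_numeral w f power2_eq_square algebra_simps del: One_nat_def)
  moreover have "fpq + 2 * e1 * fp + 3 * e1 * fq + 6 * e1\<^sup>2 * f0 = 0"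
    using two[of p q 2 1] pr q deg
    by (simp add: sum_atMost_numeral w f power2_eq_square algebra_simps del: One_nat_def)
  ultimately have "e1 * (fq + 2 * e1 * f0) = 0"
    by (simp add: power2_eq_square algebra_simps)
  with e have fq: "fq = - 2 * e1 * f0" by simp
  \<comment> \<open>Orders \<open>x_q^3\<close> flagged at \<open>q\<close> and
    \<open>x_r x_q^2\<close> flagged at \<open>r\<close>, both led by \<open>x_q^2\<close>.\<close>
  have "fqq + 4 * e1 * fq + (4 * e2 + 6 * e1\<^sup>2) * f0 = 0"
    using two[of q p 3 0] pr q deg
    by (simp add: sum_atMost_numeral w f algebra_simps del: One_nat_def)
  moreover have "fqq + 3 * e1 * fq + (3 * e2 + 3 * e1\<^sup>2) * f0 = 0"
    using two[of r q 1 2] pr q deg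
    by (simp add: sum_atMost_numeral w f algebra_simps del: One_nat_def)
  ultimately have "(e2 + e1\<^sup>2) * f0 = 0"
    by (simp add: fq power2_eq_square algebra_simps)
  moreover have "e2 + e1\<^sup>2 > 0" using e by (simp add: add_nonneg_pos)
  ultimately have "f0 = 0" by simp
  then show "?P 0 = 0" "?P (Poly_Mapping.single q 1) = 0" using fq by (simp_all add: f)
qed

text \<open>The explicit systems clear the orders up to \<open>k - 3\<close>, and the flagged
  bootstrap clears order \<open>k - 2\<close>.\<close>

lemma mult_ge_0_of_small_degree:
  assumes vars: "in_vars n P" and zeros: "\<forall>a\<in>grid m n - {(\<lambda>_. 0)}. mult_ge P a k"
    and m: "0 < m" and n: "0 < n" "k - 1 \<le> n" and k: "k \<in> {2, 3, 4}"
    and deg: "total_deg P + 1 < m * n + Suc m * (k - 1)"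
  shows "mult_ge P (\<lambda>_. 0) (k - 1)"
proof -
  note boot = mult_ge_0_bootstrap_shifted[OF vars _ m n(1)]
  have ge_0: "mult_ge P (\<lambda>_. 0) 0" by (simp add: mult_ge_def)
  have ge_1: "mult_ge P (\<lambda>_. 0) 1" if "Poly_Mapping.lookup P 0 = 0"
  proof -
    have "Poly_Mapping.lookup P (mon_of {..<n} \<alpha>) = 0" if "(\<Sum>i<n. \<alpha> i) = 0" for \<alpha>
      using that \<open>Poly_Mapping.lookup P 0 = 0\<close> by (simp add: mon_of_def)
    then show ?thesis using mult_ge_0_Suc[OF vars ge_0] by simp
  qed
  from k consider "k = 2" | "k = 3" | "k = 4" by blast
  then show ?thesis
  proof cases
    case 1
    then show ?thesis using boot[of 0] ge_0 zeros deg by (simp add: numeral_2_eq_2)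
  next
    case 2
    have "mult_ge P (\<lambda>_. 0) 1" using ge_1 const_zero_three[of n P m] vars zeros m n deg 2 by simp
    then show ?thesis using boot[of 1] zeros deg 2 by (simp add: eval_nat_numeral)
  next
    case 3
    have "mult_ge P (\<lambda>_. 0) 1" using ge_1 jet_zero_four(1)[of n P m 0] vars zeros m n deg 3 by simp
    moreover have "Poly_Mapping.lookup P (mon_of {..<n} \<alpha>) = 0" if sum: "(\<Sum>i<n. \<alpha> i) = 1" for \<alpha>
    proof -
      obtain q where q: "q < n" "\<alpha> q = 1" "\<And>i. i < n \<Longrightarrow> i \<noteq> q \<Longrightarrow> \<alpha> i = 0"
        using sum unfolding sum_eq_1_iff[OF finite_lessThan] by auto
      then have "mon_of {..<n} \<alpha> = Poly_Mapping.single q 1"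
        by (intro poly_mapping_eqI) (auto simp: lookup_mon_of lookup_single when_def)
      then show ?thesis using jet_zero_four(2)[of n P m q] vars zeros m n deg 3 q(1) by simp
    qed
    ultimately have "mult_ge P (\<lambda>_. 0) 2" using mult_ge_0_Suc[OF vars, of 1] by (simp add: numeral_2_eq_2)
    then show ?thesis using boot[of 2] zeros deg 3 by (simp add: eval_nat_numeral)
  qed
qed

section \<open>Polynomials of small degree\<close>

lemma mult_ge_mono: "mult_ge P a j \<Longrightarrow> i \<le> j \<Longrightarrow> mult_ge P a i"
  by (auto simp: mult_ge_def)

lemma mult_ge_0_left [simp]: "mult_ge 0 a j" by (simp add: mult_ge_def)

lemma mult_ge_0_right [simp]: "mult_ge P a 0" by (simp add: mult_ge_def)

lemma mult_ge_add: "mult_ge P a j \<Longrightarrow> mult_ge Q a j \<Longrightarrow> mult_ge (P + Q) a j"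
  unfolding mult_ge_def shift_add using Poly_Mapping.keys_add[of "shift P a" "shift Q a"] by blast

lemma mult_ge_mult:
  assumes "mult_ge P a i" "mult_ge Q a j"
  shows "mult_ge (P * Q) a (i + j)"
  unfolding mult_ge_def shift_mult
proof
  fix \<alpha> assume "\<alpha> \<in> Poly_Mapping.keys (shift P a * shift Q a)"
  then obtain \<beta> \<gamma> where "\<alpha> = \<beta> + \<gamma>" "\<beta> \<in> Poly_Mapping.keys (shift P a)" "\<gamma> \<in> Poly_Mapping.keys (shift Q a)"
    using keys_mult[of "shift P a" "shift Q a"] by blast
  then show "i + j \<le> mon_deg \<alpha>" using assms unfolding mult_ge_def by (simp add: mon_deg_add add_mono)
qed

lemma mult_ge_mult_left: "mult_ge P a j \<Longrightarrow> mult_ge (R * P) a j"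
  using mult_ge_mult[of R a 0 P j] by simp

lemma mult_ge_diff: "mult_ge P a j \<Longrightarrow> mult_ge Q a j \<Longrightarrow> mult_ge (P - Q) a j"
  using mult_ge_add[of P a j "- 1 * Q"] mult_ge_mult_left[of Q a j "- 1"] by simp

lemma mult_ge_prod:
  "(\<And>i. i \<in> A \<Longrightarrow> mult_ge (f i) a (e i)) \<Longrightarrow> mult_ge (prod f A) a (sum e A)"
  by (induction A rule: infinite_finite_induct) (simp_all add: mult_ge_mult)

lemma mult_ge_power: "mult_ge P a j \<Longrightarrow> mult_ge (P ^ e) a (e * j)"
  by (induction e) (simp_all add: mult_ge_mult)

lemma mult_ge_prod_factor:
  assumes "finite A" "i \<in> A" "mult_ge (f i) a j"
  shows "mult_ge (prod f A) a j"
  using assms mult_ge_mult_left[of "f i" a j "prod f (A - {i})"] by (simp add: prod.remove[of A i] mult.commute)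

lemma in_vars_0 [simp]: "in_vars n 0" by (simp add: in_vars_def)

lemma in_vars_add: "in_vars n P \<Longrightarrow> in_vars n Q \<Longrightarrow> in_vars n (P + Q)"
  unfolding in_vars_def using Poly_Mapping.keys_add[of P Q] by blast

lemma in_vars_mult:
  assumes "in_vars n P" "in_vars n Q"
  shows "in_vars n (P * Q)"
  unfolding in_vars_def
proof
  fix \<alpha> assume "\<alpha> \<in> Poly_Mapping.keys (P * Q)"
  then obtain \<beta> \<gamma> where "\<alpha> = \<beta> + \<gamma>" "\<beta> \<in> Poly_Mapping.keys P" "\<gamma> \<in> Poly_Mapping.keys Q"
    using keys_mult[of P Q] by blast
  moreover from this have "Poly_Mapping.keys \<beta> \<subseteq> {..<n}" "Poly_Mapping.keys \<gamma> \<subseteq> {..<n}"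
    using assms unfolding in_vars_def by blast+
  ultimately show "Poly_Mapping.keys \<alpha> \<subseteq> {..<n}" using Poly_Mapping.keys_add[of \<beta> \<gamma>] by blast
qed

lemma in_vars_single: "Poly_Mapping.keys \<alpha> \<subseteq> {..<n} \<Longrightarrow> in_vars n (Poly_Mapping.single \<alpha> c)"
  by (simp add: in_vars_def)

lemma in_vars_mconst: "in_vars n (mconst c)"
  unfolding mconst_def by (rule in_vars_single) simp

lemma in_vars_1: "in_vars n 1"
  using in_vars_mconst[of n 1] by (simp add: mconst_def)

lemma in_vars_mvar: "i < n \<Longrightarrow> in_vars n (mvar i)"
  unfolding mvar_def by (rule in_vars_single) simp

lemma in_vars_diff: "in_vars n P \<Longrightarrow> in_vars n Q \<Longrightarrow> in_vars n (P - Q)"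
  unfolding in_vars_def using keys_diff[of P Q] by blast

lemma in_vars_prod: "(\<And>i. i \<in> A \<Longrightarrow> in_vars n (f i)) \<Longrightarrow> in_vars n (prod f A)"
  by (induction A rule: infinite_finite_induct) (simp_all add: in_vars_mult in_vars_1)

lemma in_vars_power: "in_vars n P \<Longrightarrow> in_vars n (P ^ e)"
  by (induction e) (simp_all add: in_vars_mult in_vars_1)

section \<open>Polynomials whose top homogeneous part is one monomial\<close>

text \<open>Comparison is by total degree instead of a monomial order, so the difference between
  \<open>P\<close> and its leading monomial has strictly smaller degree.\<close>

definition monic_lead :: "mpoly_r \<Rightarrow> (nat \<Rightarrow>\<^sub>0 nat) \<Rightarrow> bool" where
  "monic_lead P \<gamma> \<longleftrightarrow> (\<forall>\<alpha>\<in>Poly_Mapping.keys (P - Poly_Mapping.single \<gamma> 1). mon_deg \<alpha> < mon_deg \<gamma>)"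

lemma monic_lead_single: "monic_lead (Poly_Mapping.single \<gamma> 1) \<gamma>"
  by (simp add: monic_lead_def)

lemma monic_lead_1: "monic_lead 1 0"
  using monic_lead_single[of 0] by simp

lemma monic_lead_mult:
  assumes "monic_lead P \<gamma>" "monic_lead Q \<delta>"
  shows "monic_lead (P * Q) (\<gamma> + \<delta>)"
  unfolding monic_lead_def
proof
  let ?g = "Poly_Mapping.single \<gamma> (1 :: real)" and ?d = "Poly_Mapping.single \<delta> (1 :: real)"
  let ?P = "P - ?g" and ?Q = "Q - ?d"
  \<comment> \<open>Each of the three products contains a remainder of lower degree than the leading
    monomial it replaces.\<close>
  have eq: "P * Q - Poly_Mapping.single (\<gamma> + \<delta>) 1 = ?P * ?Q + ?g * ?Q + ?P * ?d"
    using mult_single[of \<gamma> "1 :: real" \<delta> 1] by (simp add: algebra_simps)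
  have sub: "Poly_Mapping.keys (?P * ?Q + ?g * ?Q + ?P * ?d) \<subseteq>
      Poly_Mapping.keys (?P * ?Q) \<union> Poly_Mapping.keys (?g * ?Q) \<union> Poly_Mapping.keys (?P * ?d)"
    using Poly_Mapping.keys_add[of "?P * ?Q + ?g * ?Q" "?P * ?d"] Poly_Mapping.keys_add[of "?P * ?Q" "?g * ?Q"] by blast
  have "Poly_Mapping.keys (?g * ?Q) \<subseteq> {\<gamma> + \<epsilon> | \<epsilon>. \<epsilon> \<in> Poly_Mapping.keys ?Q}"
    using keys_mult[of ?g ?Q] by auto
  moreover have "Poly_Mapping.keys (?P * ?d) \<subseteq> {\<beta> + \<delta> | \<beta>. \<beta> \<in> Poly_Mapping.keys ?P}"
    using keys_mult[of ?P ?d] by auto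
  moreover fix \<alpha> assume "\<alpha> \<in> Poly_Mapping.keys (P * Q - Poly_Mapping.single (\<gamma> + \<delta>) 1)"
  ultimately consider \<beta> \<epsilon> where "\<alpha> = \<beta> + \<epsilon>" "\<beta> \<in> Poly_Mapping.keys ?P" "\<epsilon> \<in> Poly_Mapping.keys ?Q"
    | \<epsilon> where "\<alpha> = \<gamma> + \<epsilon>" "\<epsilon> \<in> Poly_Mapping.keys ?Q"
    | \<beta> where "\<alpha> = \<beta> + \<delta>" "\<beta> \<in> Poly_Mapping.keys ?P"
    using keys_mult[of ?P ?Q] sub unfolding eq by blast
  then show "mon_deg \<alpha> < mon_deg (\<gamma> + \<delta>)"
    using assms unfolding monic_lead_def by cases (simp_all add: mon_deg_add add_strict_mono)
qed

lemma monic_lead_prod: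
  "(\<And>i. i \<in> A \<Longrightarrow> monic_lead (f i) (\<gamma> i)) \<Longrightarrow> monic_lead (prod f A) (sum \<gamma> A)"
  by (induction A rule: infinite_finite_induct) (simp_all add: monic_lead_mult monic_lead_1)

lemma monic_lead_power_single:
  "monic_lead P (Poly_Mapping.single i d) \<Longrightarrow> monic_lead (P ^ e) (Poly_Mapping.single i (e * d))"
  by (induction e) (simp_all add: monic_lead_1 monic_lead_mult single_add)

lemma monic_lead_total_deg:
  assumes "monic_lead P \<gamma>"
  shows "total_deg P = mon_deg \<gamma>"
proof -
  have "\<gamma> \<notin> Poly_Mapping.keys (P - Poly_Mapping.single \<gamma> 1)" using assms by (auto simp: monic_lead_def)
  then have "Poly_Mapping.lookup P \<gamma> = 1" by (simp add: in_keys_iff lookup_minus)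
  then have \<gamma>: "\<gamma> \<in> Poly_Mapping.keys P" by (simp add: in_keys_iff)
  have "mon_deg \<alpha> \<le> mon_deg \<gamma>" if "\<alpha> \<in> Poly_Mapping.keys P" for \<alpha>
  proof (cases "\<alpha> = \<gamma>")
    case False
    then have "\<alpha> \<in> Poly_Mapping.keys (P - Poly_Mapping.single \<gamma> 1)"
      using that by (simp add: in_keys_iff lookup_minus lookup_single)
    then show ?thesis using assms by (auto simp: monic_lead_def intro: less_imp_le)
  qed simp
  then have "Max (mon_deg ` Poly_Mapping.keys P) = mon_deg \<gamma>" using \<gamma> by (intro Max_eqI) auto
  moreover have "P \<noteq> 0" using \<gamma> by auto
  ultimately show ?thesis by (simp add: total_deg_def)
qed

section \<open>Products of linear factors vanishing on the grid\<close>

definition node_factor :: "nat \<Rightarrow> nat \<Rightarrow> mpoly_r" where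
  "node_factor i j = mvar i + mconst (- real j)"

definition punctured_factor :: "nat \<Rightarrow> nat \<Rightarrow> mpoly_r" where
  "punctured_factor m i = (\<Prod>j=1..m. node_factor i j)"

text \<open>The polynomial \<open>g(x_i)\<close> of the overview.\<close>

definition grid_factor :: "nat \<Rightarrow> nat \<Rightarrow> mpoly_r" where
  "grid_factor m i = mvar i * punctured_factor m i"

text \<open>The polynomial \<open>u\<close> of the overview.\<close>

definition punctured :: "nat \<Rightarrow> nat \<Rightarrow> mpoly_r" where
  "punctured m n = (\<Prod>i<n. punctured_factor m i)"

lemma monic_lead_mvar: "monic_lead (mvar i) (Poly_Mapping.single i 1)"
  unfolding mvar_def by (rule monic_lead_single)

lemma monic_lead_node_factor: "monic_lead (node_factor i j) (Poly_Mapping.single i 1)"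
  by (auto simp: monic_lead_def node_factor_def mvar_def mconst_def mon_deg_single split: if_splits)

lemma monic_lead_punctured_factor: "monic_lead (punctured_factor m i) (Poly_Mapping.single i m)"
proof -
  have "monic_lead (punctured_factor m i) (\<Sum>j=1..m. Poly_Mapping.single i 1)"
    unfolding punctured_factor_def by (intro monic_lead_prod monic_lead_node_factor)
  moreover have "(\<Sum>j\<in>A. Poly_Mapping.single i (1::nat)) = Poly_Mapping.single i (card A)" if "finite A" for A :: "nat set"
    using that by (induction A rule: finite_induct) (simp_all add: single_add[symmetric] del: sum_constant)
  ultimately show ?thesis by (simp del: sum_constant)
qed

lemma monic_lead_grid_factor: "monic_lead (grid_factor m i) (Poly_Mapping.single i (Suc m))"
  using monic_lead_mult[OF monic_lead_mvar monic_lead_punctured_factor, of i m i]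
  by (simp add: grid_factor_def single_add[symmetric])

lemma monic_lead_punctured: "monic_lead (punctured m n) (mon_of {..<n} (\<lambda>_. m))"
  unfolding punctured_def mon_of_def by (intro monic_lead_prod monic_lead_punctured_factor)

lemma in_vars_punctured_factor: "i < n \<Longrightarrow> in_vars n (punctured_factor m i)"
  unfolding punctured_factor_def node_factor_def
  by (intro in_vars_prod in_vars_add in_vars_mvar in_vars_mconst)

lemma in_vars_grid_factor: "i < n \<Longrightarrow> in_vars n (grid_factor m i)"
  unfolding grid_factor_def by (intro in_vars_mult in_vars_mvar in_vars_punctured_factor)

lemma in_vars_punctured: "in_vars n (punctured m n)"
  unfolding punctured_def by (intro in_vars_prod in_vars_punctured_factor) simp

lemma mult_ge_node_factor:
  assumes "a i = real j"
  shows "mult_ge (node_factor i j) a 1"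
proof -
  have "shift (mvar i) a = mvar i + mconst (a i)"
    unfolding mvar_def[of i] shift_single by (simp add: mon_lin_def mconst_def mvar_def)
  moreover have "shift (mconst c) a = mconst c" for c
    unfolding mconst_def[of c] shift_single by (simp add: mon_lin_def mconst_def)
  ultimately have "shift (node_factor i j) a = mvar i + mconst (a i) + mconst (- real j)"
    by (simp add: node_factor_def shift_add)
  also have "\<dots> = mvar i" by (simp add: assms add.assoc mconst_add[symmetric])
  finally show ?thesis by (simp add: mult_ge_def mvar_def mon_deg_single)
qed

lemma mult_ge_mvar: "a i = 0 \<Longrightarrow> mult_ge (mvar i) a 1"
  using mult_ge_node_factor[of a i 0] by (simp add: node_factor_def)

lemma mult_ge_punctured_factor:
  assumes "a \<in> grid m n" "i < n" "a i \<noteq> 0"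
  shows "mult_ge (punctured_factor m i) a 1"
proof -
  obtain j where "j \<le> m" "a i = real j" using assms by (auto simp: grid_def)
  then show ?thesis unfolding punctured_factor_def using assms(3)
    by (intro mult_ge_prod_factor[of _ j] mult_ge_node_factor) (auto simp: Suc_le_eq intro: gr0I)
qed

lemma mult_ge_grid_factor:
  assumes "a \<in> grid m n" "i < n"
  shows "mult_ge (grid_factor m i) a 1"
  using mult_ge_mult_left[OF mult_ge_punctured_factor[OF assms], of "mvar i"]
    mult_ge_mult_left[OF mult_ge_mvar, of a i "punctured_factor m i"]
  by (cases "a i = 0") (simp_all add: grid_factor_def mult.commute)

lemma mult_ge_punctured:
  assumes "a \<in> grid m n - {(\<lambda>_. 0)}"
  shows "mult_ge (punctured m n) a 1"
proof -
  obtain i where "a i \<noteq> 0" using assms by auto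
  moreover then have "i < n" using assms by (auto simp: grid_def not_less[symmetric])
  ultimately show ?thesis unfolding punctured_def
    using assms by (intro mult_ge_prod_factor[of _ i] mult_ge_punctured_factor) auto
qed

lemma zero_in_grid: "(\<lambda>_. 0) \<in> grid m n"
  by (auto simp: grid_def)

lemma lookup_prod_0: "Poly_Mapping.lookup (prod f A) 0 = (\<Prod>i\<in>A. Poly_Mapping.lookup (f i :: mpoly_r) 0)"
  by (induction A rule: infinite_finite_induct) (simp_all add: lookup_mult_0)

lemma lookup_power_0: "Poly_Mapping.lookup (P ^ e) 0 = Poly_Mapping.lookup (P :: mpoly_r) 0 ^ e"
  by (induction e) (simp_all add: lookup_mult_0)

lemma lookup_punctured_factor_0: "Poly_Mapping.lookup (punctured_factor m i) 0 \<noteq> 0"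
proof -
  have "Poly_Mapping.single i (1 :: nat) \<noteq> 0" by (metis lookup_single_eq lookup_zero one_neq_zero)
  then show ?thesis
    by (simp add: punctured_factor_def lookup_prod_0 node_factor_def lookup_add mvar_def mconst_def lookup_single)
qed

lemma lookup_punctured_0: "Poly_Mapping.lookup (punctured m n) 0 \<noteq> 0"
  by (simp add: punctured_def lookup_prod_0 lookup_punctured_factor_0)

lemma lookup_mvar_power_mult_neq_0:
  assumes "Poly_Mapping.lookup Q 0 \<noteq> 0"
  shows "Poly_Mapping.lookup (mvar i ^ l * Q) (Poly_Mapping.single i l) \<noteq> 0"
  using lookup_single_mult_self[of "Poly_Mapping.single i l" 1 Q 0] assms by (simp add: mult_mvar_power)

lemma mult_eq_0I:
  assumes "mult_ge P (\<lambda>_. 0) l" "Poly_Mapping.lookup P (Poly_Mapping.single i l) \<noteq> 0"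
  shows "mult_eq P (\<lambda>_. 0) l"
proof -
  have "\<not> mult_ge P (\<lambda>_. 0) (Suc l)"
  proof
    assume "mult_ge P (\<lambda>_. 0) (Suc l)"
    then have "Suc l \<le> mon_deg (Poly_Mapping.single i l)"
      using assms(2) unfolding mult_ge_def shift_zero by (simp add: in_keys_iff)
    then show False by (simp add: mon_deg_single)
  qed
  with assms(1) show ?thesis by (simp add: mult_eq_def)
qed

text \<open>The witness is \<open>u * g(x_0)^(k-1)\<close>. Away from the origin \<open>u\<close>
  supplies one further zero; at the origin \<open>u\<close> is nonzero and the order comes from
  \<open>x_0^(k-1)\<close>.\<close>

lemma admissible_attained:
  assumes n: "0 < n" and k: "0 < k"
  shows "\<exists>P. admissible m n k (k - 1) P \<and> total_deg P = m * n + (m + 1) * (k - 1)"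
proof -
  let ?P = "punctured m n * grid_factor m 0 ^ (k - 1)"
  have "in_vars n ?P" using n by (intro in_vars_mult in_vars_punctured in_vars_power in_vars_grid_factor)
  moreover have "mult_ge ?P a k" if a: "a \<in> grid m n - {(\<lambda>_. 0)}" for a
  proof -
    have "mult_ge ?P a (1 + (k - 1) * 1)"
      using a n by (intro mult_ge_mult mult_ge_punctured mult_ge_power mult_ge_grid_factor[of _ _ n]) auto
    then show ?thesis using k by simp
  qed
  moreover have "mult_eq ?P (\<lambda>_. 0) (k - 1)"
  proof (rule mult_eq_0I)
    have "mult_ge ?P (\<lambda>_. 0) ((k - 1) * 1)"
      by (intro mult_ge_mult_left mult_ge_power mult_ge_grid_factor[of _ _ n] zero_in_grid n)
    then show "mult_ge ?P (\<lambda>_. 0) (k - 1)" by simp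
    have eq: "?P = mvar 0 ^ (k - 1) * (punctured m n * punctured_factor m 0 ^ (k - 1))"
      by (simp add: grid_factor_def power_mult_distrib mult_ac)
    show "Poly_Mapping.lookup ?P (Poly_Mapping.single 0 (k - 1)) \<noteq> 0"
      unfolding eq
      by (rule lookup_mvar_power_mult_neq_0)
         (simp add: lookup_mult_0 lookup_power_0 lookup_punctured_0 lookup_punctured_factor_0)
  qed
  moreover have "total_deg ?P = m * n + (m + 1) * (k - 1)"
  proof -
    have "monic_lead ?P (mon_of {..<n} (\<lambda>_. m) + Poly_Mapping.single 0 ((k - 1) * Suc m))"
      by (intro monic_lead_mult monic_lead_punctured monic_lead_power_single monic_lead_grid_factor)
    from monic_lead_total_deg[OF this] show ?thesis by (simp add: mon_deg_add mon_deg_mon_of mon_deg_single)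
  qed
  ultimately show ?thesis unfolding admissible_def by blast
qed

section \<open>Degree reduction modulo negligible polynomials\<close>

text \<open>Greedy choice; it serves to trim a supply of at least \<open>k\<close> grid factors to
  exactly \<open>k\<close>.\<close>

lemma exists_subfunction_sum:
  fixes f :: "'a \<Rightarrow> nat"
  assumes "finite A" "j \<le> (\<Sum>i\<in>A. f i)"
  shows "\<exists>\<beta>. (\<forall>i. \<beta> i \<le> f i) \<and> (\<Sum>i\<in>A. \<beta> i) = j"
  using assms
proof (induction A arbitrary: j rule: finite_induct)
  case empty
  then show ?case by (intro exI[of _ "\<lambda>_. 0"]) simp
next
  case (insert x A)
  have "j - min j (f x) \<le> sum f A" using insert by simp
  then obtain \<beta> where \<beta>: "\<forall>i. \<beta> i \<le> f i" "sum \<beta> A = j - min j (f x)" using insert.IH by blast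
  have "sum (\<beta>(x := min j (f x))) A = sum \<beta> A" using insert.hyps by (intro sum.cong) auto
  then show ?case using \<beta> insert.hyps by (intro exI[of _ "\<beta>(x := min j (f x))"]) simp
qed

text \<open>Subtracting such a polynomial changes neither the conditions away from the origin nor the jet
  of order at most \<open>k - 2\<close> at the origin.\<close>

definition negligible :: "nat \<Rightarrow> nat \<Rightarrow> nat \<Rightarrow> mpoly_r \<Rightarrow> bool" where
  "negligible m n k Q \<longleftrightarrow> in_vars n Q \<and> (\<forall>a\<in>grid m n - {(\<lambda>_. 0)}. mult_ge Q a k) \<and>
     mult_ge Q (\<lambda>_. 0) (k - 1)"

lemma negligible_add: "negligible m n k P \<Longrightarrow> negligible m n k Q \<Longrightarrow> negligible m n k (P + Q)"
  by (simp add: negligible_def in_vars_add mult_ge_add)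

lemma negligible_mult_mconst: "negligible m n k P \<Longrightarrow> negligible m n k (mconst c * P)"
  by (simp add: negligible_def in_vars_mult in_vars_mconst mult_ge_mult_left)

lemma negligible_0: "negligible m n k 0"
  by (simp add: negligible_def)

text \<open>Write the exponents as \<open>(m + 1) f\<^sub>i + r\<^sub>i\<close>. Either \<open>\<Sum> f\<^sub>i \<ge> k\<close> and the leading monomial of a product
  of \<open>k\<close> grid factors divides the monomial, or the degree bound forces \<open>\<Sum> f\<^sub>i = k - 1\<close> and all \<open>r\<^sub>i = m\<close>.\<close>

lemma negligible_monic_lead:
  assumes keys: "Poly_Mapping.keys \<gamma> \<subseteq> {..<n}" and k: "0 < k"
    and deg: "m * n + Suc m * (k - 1) \<le> mon_deg \<gamma>"
  shows "\<exists>Q. negligible m n k Q \<and> monic_lead Q \<gamma>"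
proof -
  define c where "c = Poly_Mapping.lookup \<gamma>"
  define f where "f i = c i div Suc m" for i
  define G where "G \<beta> = (\<Prod>i<n. grid_factor m i ^ \<beta> i)" for \<beta> :: "nat \<Rightarrow> nat"
  have \<gamma>: "\<gamma> = mon_of {..<n} c" using keys by (simp add: c_def mon_of_lookup)
  have sum_c: "mon_deg \<gamma> = (\<Sum>i<n. c i)" using keys by (simp add: c_def mon_deg_eq_sum)
  have G_vars: "in_vars n (G \<beta>)" for \<beta>
    unfolding G_def by (intro in_vars_prod in_vars_power in_vars_grid_factor) simp
  have G_lead: "monic_lead (G \<beta>) (mon_of {..<n} (\<lambda>i. \<beta> i * Suc m))" for \<beta>
    unfolding G_def mon_of_def by (intro monic_lead_prod monic_lead_power_single monic_lead_grid_factor)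
  have G_mult: "mult_ge (G \<beta>) a (\<Sum>i<n. \<beta> i)" if "a \<in> grid m n" for a \<beta>
  proof -
    have "mult_ge (G \<beta>) a (\<Sum>i<n. \<beta> i * 1)"
      unfolding G_def using that by (intro mult_ge_prod mult_ge_power mult_ge_grid_factor[of _ _ n]) auto
    then show ?thesis by simp
  qed
  have mon_of_add: "mon_of {..<n} x + mon_of {..<n} y = mon_of {..<n} (\<lambda>i. x i + y i)" for x y
    by (simp add: mon_of_def single_add sum.distrib)
  show ?thesis
  proof (cases "k \<le> (\<Sum>i<n. f i)")
    case True
    then obtain \<beta> where \<beta>: "\<And>i. \<beta> i \<le> f i" "(\<Sum>i<n. \<beta> i) = k"
      using exists_subfunction_sum[of "{..<n}" k f] by auto
    define r where "r i = c i - \<beta> i * Suc m" for i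
    have "\<beta> i * Suc m \<le> c i" for i
      using \<beta>(1)[of i] unfolding f_def by (meson div_times_less_eq_dividend le_trans mult_le_mono1)
    then have "\<gamma> = mon_of {..<n} r + mon_of {..<n} (\<lambda>i. \<beta> i * Suc m)"
      unfolding mon_of_add \<gamma> r_def by (simp del: mult_Suc_right)
    then have "monic_lead (Poly_Mapping.single (mon_of {..<n} r) 1 * G \<beta>) \<gamma>"
      by (simp only: monic_lead_mult monic_lead_single G_lead)
    moreover have ge: "mult_ge (Poly_Mapping.single (mon_of {..<n} r) 1 * G \<beta>) a k" if "a \<in> grid m n" for a
      using G_mult[OF that, of \<beta>] \<beta>(2) by (intro mult_ge_mult_left) simp
    have "negligible m n k (Poly_Mapping.single (mon_of {..<n} r) 1 * G \<beta>)"
      unfolding negligible_def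
      using ge mult_ge_mono[OF ge[OF zero_in_grid], of "k - 1"] G_vars
      by (auto intro!: in_vars_mult in_vars_single keys_mon_of)
    ultimately show ?thesis by blast
  next
    case False
    have c_le: "c i \<le> f i * Suc m + m" for i
      unfolding f_def using div_mult_mod_eq[of "c i" "Suc m"] mod_less_divisor[of "Suc m" "c i"]
      by (metis add_le_cancel_left less_Suc_eq_le zero_less_Suc)
    have sum_eq: "(\<Sum>i<n. f i * Suc m + m) = Suc m * (\<Sum>i<n. f i) + m * n"
      by (simp only: sum.distrib sum_distrib_right[symmetric]) simp
    have "Suc m * (\<Sum>i<n. f i) \<le> Suc m * (k - 1)" using False by (intro mult_le_mono2) simp
    moreover have le: "(\<Sum>i<n. c i) \<le> (\<Sum>i<n. f i * Suc m + m)" by (intro sum_mono c_le)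
    \<comment> \<open>The degree bound from below and the two estimates from above meet, so all of
      them are equalities.\<close>
    ultimately have eq: "(\<Sum>i<n. c i) = (\<Sum>i<n. f i * Suc m + m)" "Suc m * (\<Sum>i<n. f i) = Suc m * (k - 1)"
      using deg unfolding sum_eq sum_c by linarith+
    have "c i = m + f i * Suc m" if "i < n" for i
    proof (rule ccontr)
      assume "c i \<noteq> m + f i * Suc m"
      then have "c i < f i * Suc m + m" using c_le[of i] by linarith
      then have "(\<Sum>i<n. c i) < (\<Sum>i<n. f i * Suc m + m)"
        using that c_le by (intro sum_strict_mono_ex1) auto
      then show False using eq(1) by simp
    qed
    then have "\<gamma> = mon_of {..<n} (\<lambda>_. m) + mon_of {..<n} (\<lambda>i. f i * Suc m)"
      unfolding mon_of_add \<gamma> by (simp add: mon_of_def)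
    then have "monic_lead (punctured m n * G f) \<gamma>"
      by (simp only: monic_lead_mult monic_lead_punctured G_lead)
    moreover have sum_f: "(\<Sum>i<n. f i) = k - 1" using eq(2) by (simp only: mult_cancel1) simp
    have "negligible m n k (punctured m n * G f)"
      unfolding negligible_def
    proof (intro conjI ballI)
      show "in_vars n (punctured m n * G f)" by (intro in_vars_mult in_vars_punctured G_vars)
      show "mult_ge (punctured m n * G f) (\<lambda>_. 0) (k - 1)"
        using mult_ge_mult_left[OF G_mult[OF zero_in_grid]] sum_f by metis
      fix a assume a: "a \<in> grid m n - {(\<lambda>_. 0)}"
      then have "mult_ge (punctured m n * G f) a (1 + (k - 1))"
        using mult_ge_mult[OF mult_ge_punctured[OF a] G_mult[of a f]] sum_f by simp
      then show "mult_ge (punctured m n * G f) a k" using k by simp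
    qed
    ultimately show ?thesis by blast
  qed
qed

text \<open>Congruence modulo negligible polynomials to something below the bound of (i). Bounding
  monomials instead of \<open>total_deg\<close> treats a zero remainder uniformly.\<close>

definition reducible :: "nat \<Rightarrow> nat \<Rightarrow> nat \<Rightarrow> mpoly_r \<Rightarrow> bool" where
  "reducible m n k P \<longleftrightarrow> (\<exists>Q. negligible m n k Q \<and>
     (\<forall>\<alpha>\<in>Poly_Mapping.keys (P - Q). mon_deg \<alpha> < m * n + Suc m * (k - 1)))"

lemma reducible_add:
  assumes "reducible m n k P" "reducible m n k P'"
  shows "reducible m n k (P + P')"
proof -
  obtain Q Q' where Q: "negligible m n k Q" "negligible m n k Q'"
    and deg: "\<forall>\<alpha>\<in>Poly_Mapping.keys (P - Q) \<union> Poly_Mapping.keys (P' - Q'). mon_deg \<alpha> < m * n + Suc m * (k - 1)"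
    using assms unfolding reducible_def by blast
  have "P + P' - (Q + Q') = (P - Q) + (P' - Q')" by simp
  then have "Poly_Mapping.keys (P + P' - (Q + Q')) \<subseteq> Poly_Mapping.keys (P - Q) \<union> Poly_Mapping.keys (P' - Q')"
    using Poly_Mapping.keys_add[of "P - Q" "P' - Q'"] by (simp only:)
  with deg negligible_add[OF Q] show ?thesis unfolding reducible_def by blast
qed

lemma keys_mconst_mult: "Poly_Mapping.keys (mconst c * P) \<subseteq> Poly_Mapping.keys P"
  using keys_mult[of "mconst c" P] by (auto simp: mconst_def split: if_splits)

lemma reducible_mult_mconst:
  assumes "reducible m n k P"
  shows "reducible m n k (mconst c * P)"
proof -
  obtain Q where Q: "negligible m n k Q" "\<forall>\<alpha>\<in>Poly_Mapping.keys (P - Q). mon_deg \<alpha> < m * n + Suc m * (k - 1)"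
    using assms unfolding reducible_def by blast
  have "mconst c * P - mconst c * Q = mconst c * (P - Q)" by (simp add: right_diff_distrib)
  then have "Poly_Mapping.keys (mconst c * P - mconst c * Q) \<subseteq> Poly_Mapping.keys (P - Q)"
    using keys_mconst_mult[of c "P - Q"] by simp
  with Q negligible_mult_mconst show ?thesis unfolding reducible_def by blast
qed

lemma reducible_of_monomials:
  assumes "\<And>\<alpha>. \<alpha> \<in> Poly_Mapping.keys P \<Longrightarrow> reducible m n k (Poly_Mapping.single \<alpha> 1)"
  shows "reducible m n k P"
proof -
  have "reducible m n k (\<Sum>\<alpha>\<in>A. mconst (Poly_Mapping.lookup P \<alpha>) * Poly_Mapping.single \<alpha> 1)"
    if "finite A" "A \<subseteq> Poly_Mapping.keys P" for A
    using that
  proof (induction A rule: finite_induct)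
    case empty
    show ?case unfolding reducible_def by (rule exI[of _ 0]) (simp add: negligible_0)
  next
    case (insert x A)
    then show ?case using assms by (simp add: reducible_add reducible_mult_mconst)
  qed
  from this[OF finite_keys order_refl] show ?thesis
    by (simp add: mconst_def mult_single flip: poly_mapping_sum_single)
qed

text \<open>Strong induction on the degree: subtracting a negligible polynomial with this leading
  monomial leaves only monomials of lower degree.\<close>

lemma reducible_monomial:
  assumes "Poly_Mapping.keys \<gamma> \<subseteq> {..<n}" "0 < k"
  shows "reducible m n k (Poly_Mapping.single \<gamma> 1)"
  using assms
proof (induction "mon_deg \<gamma>" arbitrary: \<gamma> rule: less_induct)
  case less
  show ?case
  proof (cases "mon_deg \<gamma> < m * n + Suc m * (k - 1)")
    case True
    then show ?thesis unfolding reducible_def by (intro exI[of _ 0]) (simp add: negligible_0)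
  next
    case False
    then obtain Q where Q: "negligible m n k Q" "monic_lead Q \<gamma>"
      using negligible_monic_lead[of \<gamma> n k m] less.prems by auto
    let ?R = "Poly_Mapping.single \<gamma> 1 - Q"
    have "in_vars n ?R" using Q less.prems by (intro in_vars_diff in_vars_single) (auto simp: negligible_def)
    moreover have "mon_deg \<alpha> < mon_deg \<gamma>" if "\<alpha> \<in> Poly_Mapping.keys ?R" for \<alpha>
    proof -
      have "\<alpha> \<in> Poly_Mapping.keys (Q - Poly_Mapping.single \<gamma> 1)"
        using that by (simp add: in_keys_iff lookup_minus)
      then show ?thesis using Q(2) by (simp add: monic_lead_def)
    qed
    ultimately have "reducible m n k (Poly_Mapping.single \<alpha> 1)" if "\<alpha> \<in> Poly_Mapping.keys ?R" for \<alpha>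
      using less.hyps[of \<alpha>] less.prems(2) that by (simp add: in_vars_def)
    then have "reducible m n k ?R" by (rule reducible_of_monomials)
    moreover have "reducible m n k Q" unfolding reducible_def using Q(1) by (intro exI[of _ Q]) simp
    ultimately show ?thesis using reducible_add[of m n k ?R Q] by simp
  qed
qed

text \<open>Reduce \<open>x_0^l * u^k\<close>. The negligible part starts at order
  \<open>k - 1 > l\<close> at the origin, so the coefficient of \<open>x_0^l\<close> survives; it is
  nonzero because \<open>u\<close> does not vanish there.\<close>

lemma admissible_small_degree_exists:
  assumes n: "0 < n" and k: "2 \<le> k" and l: "l \<le> k - 2"
  shows "\<exists>P. admissible m n k l P \<and> total_deg P < m * n + Suc m * (k - 1)"
proof -
  let ?P = "mvar 0 ^ l * punctured m n ^ k"
  have vars: "in_vars n ?P" by (intro in_vars_mult in_vars_power in_vars_mvar in_vars_punctured n)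
  have "reducible m n k ?P"
  proof (rule reducible_of_monomials)
    fix \<alpha> assume "\<alpha> \<in> Poly_Mapping.keys ?P"
    then have "Poly_Mapping.keys \<alpha> \<subseteq> {..<n}" using vars unfolding in_vars_def by blast
    then show "reducible m n k (Poly_Mapping.single \<alpha> 1)" using k by (intro reducible_monomial) auto
  qed
  then obtain Q where Q: "negligible m n k Q"
    and deg: "\<forall>\<alpha>\<in>Poly_Mapping.keys (?P - Q). mon_deg \<alpha> < m * n + Suc m * (k - 1)"
    unfolding reducible_def by blast
  have "mult_ge ?P a k" if "a \<in> grid m n - {(\<lambda>_. 0)}" for a
    using mult_ge_mult_left[OF mult_ge_power[OF mult_ge_punctured[OF that], of k]] by simp
  then have "\<forall>a\<in>grid m n - {(\<lambda>_. 0)}. mult_ge (?P - Q) a k"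
    using Q by (auto simp: negligible_def intro: mult_ge_diff)
  moreover have "mult_eq (?P - Q) (\<lambda>_. 0) l"
  proof (rule mult_eq_0I)
    have "mult_ge (mvar 0 ^ l) (\<lambda>_. 0) (l * 1)" by (intro mult_ge_power mult_ge_mvar) simp
    then have "mult_ge ?P (\<lambda>_. 0) l"
      using mult_ge_mult_left[of "mvar 0 ^ l" "\<lambda>_. 0" l "punctured m n ^ k"] by (simp add: mult.commute)
    moreover have Q0: "mult_ge Q (\<lambda>_. 0) (k - 1)" using Q by (simp add: negligible_def)
    then have "mult_ge Q (\<lambda>_. 0) l" by (rule mult_ge_mono) (use l in simp)
    ultimately show "mult_ge (?P - Q) (\<lambda>_. 0) l" by (rule mult_ge_diff)
    have "\<not> k - 1 \<le> mon_deg (Poly_Mapping.single 0 l)" using l k by (simp add: mon_deg_single)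
    then have "Poly_Mapping.lookup Q (Poly_Mapping.single 0 l) = 0"
      using Q0 unfolding mult_ge_def shift_zero by (auto simp: in_keys_iff)
    then show "Poly_Mapping.lookup (?P - Q) (Poly_Mapping.single 0 l) \<noteq> 0"
      by (simp add: lookup_minus lookup_mvar_power_mult_neq_0 lookup_power_0 lookup_punctured_0)
  qed
  moreover have "in_vars n (?P - Q)" using vars Q by (intro in_vars_diff) (simp_all add: negligible_def)
  ultimately have adm: "admissible m n k l (?P - Q)" by (simp add: admissible_def)
  \<comment> \<open>The zero polynomial has every multiplicity, so an exact multiplicity excludes it
    and \<open>total_deg\<close> is a genuine maximum.\<close>
  have "?P - Q \<noteq> 0" using adm by (auto simp: admissible_def mult_eq_def)
  then have "total_deg (?P - Q) < m * n + Suc m * (k - 1)"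
    using deg by (simp add: total_deg_def)
  with adm show ?thesis by blast
qed

theorem theorem1p5:
  fixes m n k :: nat
  assumes "0 < m" and "0 < n" and "2 \<le> k"
  shows "(\<forall>P. admissible m n k (k - 1) P \<longrightarrow> m * n + (m + 1) * (k - 1) \<le> total_deg P)
    \<and> (\<forall>P l. l \<le> k - 2 \<and> k \<in> {2, 3, 4} \<and> k - 1 \<le> n \<and> admissible m n k l P
            \<longrightarrow> m * n + (m + 1) * (k - 1) - 1 \<le> total_deg P)
    \<and> (\<exists>P. admissible m n k (k - 1) P \<and> total_deg P = m * n + (m + 1) * (k - 1))
    \<and> (k \<in> {2, 3, 4} \<and> k - 1 \<le> n \<longrightarrow>
        (\<forall>l\<le>k - 2. \<exists>P. admissible m n k l P \<and> total_deg P = m * n + (m + 1) * (k - 1) - 1))"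
proof -
  have lower_eq: "m * n + (m + 1) * (k - 1) \<le> total_deg P" if adm: "admissible m n k (k - 1) P" for P
  proof (rule ccontr)
    assume "\<not> ?thesis"
    \<comment> \<open>A smaller degree would raise the multiplicity at the origin from
      \<open>k - 1\<close> to \<open>k\<close>.\<close>
    then have "mult_ge P (\<lambda>_. 0) (Suc (k - 1))"
      using adm assms by (intro mult_ge_0_bootstrap[of n P m]) (auto simp: admissible_def mult_eq_def)
    then show False using adm by (simp add: admissible_def mult_eq_def)
  qed
  have lower: "m * n + (m + 1) * (k - 1) - 1 \<le> total_deg P"
    if l: "l \<le> k - 2" and k: "k \<in> {2, 3, 4}" "k - 1 \<le> n" and adm: "admissible m n k l P" for P l
  proof (rule ccontr)
    assume "\<not> ?thesis"
    then have "total_deg P + 1 < m * n + Suc m * (k - 1)" by simp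
    then have "mult_ge P (\<lambda>_. 0) (k - 1)"
      using adm k assms by (intro mult_ge_0_of_small_degree[of n P m k]) (auto simp: admissible_def)
    moreover have "Suc l \<le> k - 1" using l assms(3) by simp
    ultimately have "mult_ge P (\<lambda>_. 0) (Suc l)" by (rule mult_ge_mono)
    then show False using adm by (simp add: admissible_def mult_eq_def)
  qed
  have "\<exists>P. admissible m n k l P \<and> total_deg P = m * n + (m + 1) * (k - 1) - 1"
    if k: "k \<in> {2, 3, 4}" "k - 1 \<le> n" and l: "l \<le> k - 2" for l
  proof -
    obtain P where P: "admissible m n k l P" "total_deg P < m * n + Suc m * (k - 1)"
      using admissible_small_degree_exists[OF assms(2,3) l] by blast
    \<comment> \<open>The strict upper bound from the construction meets the lower bound of
      (ii).\<close>
    then have "total_deg P = m * n + (m + 1) * (k - 1) - 1" using lower[OF l k P(1)] by simp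
    with P(1) show ?thesis by blast
  qed
  moreover have "0 < k" using assms(3) by simp
  ultimately show ?thesis
    using lower_eq lower admissible_attained[OF assms(2), of k m] by blast
qed

end
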